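(* Let $B$ and $R$ be two finite simple graphs with the same vertex set $V$. Then either the pair $(B,R)$ is additive, or at least one of the following holds: (1) one of $B, R$ contains a member of $\mathcal{F}$; (2) both $B$ and $R$ contain $C_5$; (3) both $B$ and $R$ contain $P_0^c$; (4) $B$ contains $P_0^c$, and $R$ contains a member of $\mathcal{P}$; (5) $R$ contains $P_0^c$, and $B$ contains a member of $\mathcal{P}$.
   Context: All graphs are finite and simple. A clique in a graph $G$ is a set of pairwise adjacent vertices, and $\omega(G)$ denotes the largest size of a clique in $G$. The complement $G^c$ of $G$ is the graph with vertex set $V(G)$ in which two (distinct) vertices are adjacent if and only if they are non-adjacent in $G$. A stable set of $G$ is a clique of $G^c$. For $X \subseteq V(G)$, $G|X$ is the subgraph of $G$ induced by $X$. A graph $G$ contains a graph $H$ if some induced subgraph of $G$ is isomorphic to $H$. $C_k$ denotes the cycle on $k$ vertices. For graphs $B$ and $R$ with the same vertex set $V$, $G(B,R)$ is the graph with vertex set $V$ in which two vertices are adjacent if they are adjacent in at least one of $B$ and $R$. The pair $(B,R)$ is additive if for every $X \subseteq V$, $$\omega(B|X)+\omega(R|X) \geq \omega(G(B,R)|X).$$ $\mathcal{F}$ is the family of graphs with vertex set $\{a_1,a_2,a_3,b_1,b_2,b_3\}$ (six distinct vertices) where $\{a_1,a_2,a_3\}$ and $\{b_1,b_2,b_3\}$ are cliques, $a_i$ is non-adjacent to $b_i$ for $i \in \{1,2,3\}$, and the remaining adjacencies (between $a_i$ and $b_j$ with $i \neq j$) are arbitrary. $P_0$ is the graph with vertex set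 $\{a_1,a_2,a_3,b_1,b_2,b_3,c\}$ (seven distinct vertices) where: $\{a_1,a_2,a_3\}$ is a clique; $\{b_1,b_2,b_3\}$ is a stable set; for $i \in \{1,2,3\}$, $b_i$ is non-adjacent to $a_i$ and adjacent to both vertices of $\{a_1,a_2,a_3\}\setminus\{a_i\}$; and $c$ is adjacent to $b_1$ and has no other neighbors in $P_0$. $P_1$ is the graph obtained from $P_0$ by adding the edge $cb_2$, and $P_2$ is the graph obtained from $P_1$ by adding the edge $cb_3$. Set $\mathcal{P}=\{P_0,P_1,P_2\}$. *)

theory Defs
  imports "Graph_Theory.Digraph_Isomorphism"
begin

text \<open>
  A finite simple graph is a value of type \<open>'a pair_pre_digraph\<close> satisfying \<^locale>\<open>pair_graph\<close>:
  a finite vertex set with a symmetric, irreflexive arc relation on it. The notions below that take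
  a \<open>pre_digraph\<close> are applied to such graphs through the coercion \<^const>\<open>with_proj\<close>.
\<close>

definition clique :: "('a, 'b) pre_digraph \<Rightarrow> 'a set \<Rightarrow> bool" where
  "clique G K \<longleftrightarrow> K \<subseteq> verts G \<and> (\<forall>u\<in>K. \<forall>v\<in>K. u \<noteq> v \<longrightarrow> u \<rightarrow>\<^bsub>G\<^esub> v)"

text \<open>The empty set is a clique, so the clique number of the graph with no vertices is 0.\<close>

definition clique_number :: "('a, 'b) pre_digraph \<Rightarrow> nat" (\<open>\<omega>\<close>) where
  "\<omega> G = Max (card ` {K. clique G K})"

definition complement :: "'a pair_pre_digraph \<Rightarrow> 'a pair_pre_digraph" where
  "complement G = \<lparr> pverts = pverts G,
     parcs = {(u, v). u \<in> pverts G \<and> v \<in> pverts G \<and> u \<noteq> v \<and> (u, v) \<notin> parcs G} \<rparr>"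

definition contains :: "'a pair_pre_digraph \<Rightarrow> 'b pair_pre_digraph \<Rightarrow> bool" where
  "contains G H \<longleftrightarrow> (\<exists>S. induced_subgraph S (with_proj G) \<and> digraph_iso S (with_proj H))"

text \<open>
  For graphs \<open>B\<close> and \<open>R\<close> with the same vertex set, \<open>union B R\<close> is the graph $G(B,R)$, and
  \<open>G \<restriction> X\<close> is the subgraph $G|X$ induced by \<open>X\<close>.
\<close>

definition additive_pair :: "'a pair_pre_digraph \<Rightarrow> 'a pair_pre_digraph \<Rightarrow> bool" where
  "additive_pair B R \<longleftrightarrow>
     (\<forall>X \<subseteq> pverts B. \<omega> (with_proj B \<restriction> X) + \<omega> (with_proj R \<restriction> X)
        \<ge> \<omega> (union (with_proj B) (with_proj R) \<restriction> X))"

text \<open>Only used for \<open>k \<ge> 3\<close>.\<close>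

definition cycle_graph :: "nat \<Rightarrow> nat pair_pre_digraph" where
  "cycle_graph k = \<lparr> pverts = {..<k},
     parcs = {(i, j). i < k \<and> j < k \<and> (j = (i + 1) mod k \<or> i = (j + 1) mod k)} \<rparr>"

text \<open>\<open>va i\<close>, \<open>vb i\<close> and \<open>vc\<close> are the vertices $a_i$, $b_i$ and $c$; the indices are 1, 2, 3.\<close>

datatype vertex = va nat | vb nat | vc

definition family_F :: "vertex pair_pre_digraph set" where
  "family_F = {G. pair_graph G \<and> pverts G = va ` {1,2,3} \<union> vb ` {1,2,3} \<and>
     clique (with_proj G) (va ` {1,2,3}) \<and> clique (with_proj G) (vb ` {1,2,3}) \<and>
     (\<forall>i\<in>{1,2,3}. (va i, vb i) \<notin> parcs G)}"

definition add_edge :: "'a pair_pre_digraph \<Rightarrow> 'a \<Rightarrow> 'a \<Rightarrow> 'a pair_pre_digraph" where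
  "add_edge G u v = G \<lparr> parcs := parcs G \<union> {(u, v), (v, u)} \<rparr>"

definition P0 :: "vertex pair_pre_digraph" where
  "P0 = (let E = {(va i, va j) | i j. i \<in> {1,2,3} \<and> j \<in> {1,2,3} \<and> i \<noteq> j}
               \<union> {(va i, vb j) | i j. i \<in> {1,2,3} \<and> j \<in> {1,2,3} \<and> i \<noteq> j}
               \<union> {(vc, vb 1)}
         in \<lparr> pverts = va ` {1,2,3} \<union> vb ` {1,2,3} \<union> {vc}, parcs = E \<union> E\<inverse> \<rparr>)"

definition P1 :: "vertex pair_pre_digraph" where
  "P1 = add_edge P0 vc (vb 2)"

definition P2 :: "vertex pair_pre_digraph" where
  "P2 = add_edge P1 vc (vb 3)"

definition family_P :: "vertex pair_pre_digraph set" where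
  "family_P = {P0, P1, P2}"

end

theory Submission
  imports Defs
begin

text \<open>
  Let \<open>W\<close> be a minimal set violating additivity; it may be taken to be a clique of the union. The
  complements \<open>h\<close> and \<open>k\<close> of the two graphs on \<open>W\<close> are then edge-disjoint, with stability numbers
  \<open>a\<close> and \<open>b\<close>, \<open>|W| = a + b + 1\<close>, and every vertex is missed by a maximum stable set of \<open>h\<close> and by
  one of \<open>k\<close>. By Hall's theorem, excluding \<open>family_F\<close> makes any two maximum stable sets differ in at
  most two elements. If \<open>a \<ge> 3\<close>, this rigidity yields a ``net'' in \<open>h\<close>: a maximum stable set \<open>Y\<close>
  matched to a clique of the same size. That clique is stable in \<open>k\<close>, so \<open>a = b\<close> and the nets of
  \<open>h\<close> and \<open>k\<close> each leave out just one vertex. Comparing them leaves the 5-cycle or \<open>P0\<close>, \<open>P1\<close>,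
  \<open>P2\<close> and complements. If \<open>a, b \<le> 2\<close>, then \<open>|W| = 5\<close> and both graphs are 5-cycles.
\<close>

section \<open>Maximum stable sets\<close>

text \<open>Hall's marriage theorem, by the Halmos-Vaughan induction: if some nonempty proper
  \<open>J\<close> is tight, \<open>J\<close> and \<open>I - J\<close> are matched separately;
  otherwise all such sets have a surplus and any first choice can be made.\<close>

lemma hall_selection:
  fixes A :: "'i \<Rightarrow> 'b set"
  assumes "finite I" and "\<And>i. i \<in> I \<Longrightarrow> finite (A i)"
    and "\<And>J. J \<subseteq> I \<Longrightarrow> card J \<le> card (\<Union>(A ` J))"
  shows "\<exists>f. inj_on f I \<and> (\<forall>i\<in>I. f i \<in> A i)"
  using assms
proof (induction "card I" arbitrary: I A rule: less_induct)
  case less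
  note finI = less.prems(1) and finA = less.prems(2) and hall = less.prems(3)
  have finU: "finite (\<Union>(A ` J))" if "J \<subseteq> I" for J
    using that finI finA by (meson finite_UN finite_subset subsetD)
  show ?case
  proof (cases "\<exists>J. J \<noteq> {} \<and> J \<subset> I \<and> card (\<Union>(A ` J)) \<le> card J")
    case True
    then obtain J where J: "J \<noteq> {}" "J \<subset> I" "card (\<Union>(A ` J)) \<le> card J" by blast
    let ?U = "\<Union>(A ` J)"
    have finJ: "finite J" using J(2) finI by (meson finite_subset psubset_imp_subset)
    have "card J < card I" using J(2) finI by (rule psubset_card_mono[rotated])
    then have "\<exists>f. inj_on f J \<and> (\<forall>i\<in>J. f i \<in> A i)"
    proof (intro less.hyps)
      fix K assume "K \<subseteq> J"
      then show "card K \<le> card (\<Union>(A ` K))" using J(2) by (intro hall) auto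
    qed (use J(2) finJ finA in auto)
    then obtain f where f: "inj_on f J" "\<And>i. i \<in> J \<Longrightarrow> f i \<in> A i" by blast
    \<comment> \<open>As \<open>J\<close> is tight, Hall's condition for \<open>K \<union> J\<close>
      leaves at least \<open>card K\<close> elements outside \<open>?U\<close>.\<close>
    have "\<exists>g. inj_on g (I - J) \<and> (\<forall>i\<in>I - J. g i \<in> A i - ?U)"
    proof (intro less.hyps)
      show "card (I - J) < card I" using J finI by (intro psubset_card_mono) auto
      fix K assume K: "K \<subseteq> I - J"
      have finK: "finite K" using K finI by (meson finite_Diff finite_subset)
      have "card K + card J = card (K \<union> J)"
        using K by (subst card_Un_disjoint) (auto simp: finK finJ)
      also have "\<dots> \<le> card (\<Union>(A ` (K \<union> J)))" using K J(2) by (intro hall) auto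
      also have "\<Union>(A ` (K \<union> J)) = (\<Union>i\<in>K. A i - ?U) \<union> ?U" by auto
      also have "card \<dots> \<le> card (\<Union>i\<in>K. A i - ?U) + card ?U" by (rule card_Un_le)
      finally show "card K \<le> card (\<Union>((\<lambda>i. A i - ?U) ` K))" using J(3) by linarith
    qed (use finI finA in auto)
    then obtain g where g: "inj_on g (I - J)" "\<And>i. i \<in> I - J \<Longrightarrow> g i \<in> A i - ?U" by blast
    define k where "k i = (if i \<in> J then f i else g i)" for i
    have "inj_on k I"
    proof (rule inj_onI)
      fix x y assume xy: "x \<in> I" "y \<in> I" "k x = k y"
      show "x = y"
        using xy inj_onD[OF f(1), of x y] inj_onD[OF g(1), of x y] f(2)[of x] f(2)[of y] g(2)[of x] g(2)[of y]
        by (fastforce simp: k_def split: if_splits)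
    qed
    moreover have "\<forall>i\<in>I. k i \<in> A i" using f(2) g(2) by (auto simp: k_def)
    ultimately show ?thesis by blast
  next
    case False
    show ?thesis
    proof (cases "I = {}")
      case False
      then obtain i where i: "i \<in> I" by blast
      have "card {i} \<le> card (\<Union>(A ` {i}))" using i by (intro hall) auto
      then obtain x where x: "x \<in> A i" by fastforce
      have "\<exists>g. inj_on g (I - {i}) \<and> (\<forall>j\<in>I - {i}. g j \<in> A j - {x})"
      proof (intro less.hyps)
        show "card (I - {i}) < card I" using i finI by (intro psubset_card_mono) auto
        fix K assume K: "K \<subseteq> I - {i}"
        show "card K \<le> card (\<Union>((\<lambda>j. A j - {x}) ` K))"
        proof (cases "K = {}")
          case False
          have Kless: "K \<subset> I" using K i by blast
          \<comment> \<open>The surplus of one makes up for the loss of \<open>x\<close>.\<close>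
          have "card K < card (\<Union>(A ` K))"
            using \<open>\<not> (\<exists>J. J \<noteq> {} \<and> J \<subset> I \<and> card (\<Union>(A ` J)) \<le> card J)\<close> False Kless
            by (meson not_le)
          also have "\<dots> \<le> Suc (card (\<Union>(A ` K) - {x}))"
            by (simp add: card_Diff_singleton_if) arith
          also have "\<Union>(A ` K) - {x} = \<Union>((\<lambda>j. A j - {x}) ` K)" by auto
          finally show ?thesis by simp
        qed simp
      qed (use finI finA in auto)
      then obtain g where g: "inj_on g (I - {i})" "\<And>j. j \<in> I - {i} \<Longrightarrow> g j \<in> A j - {x}" by blast
      have "inj_on (g(i := x)) I" using g i
        by (auto simp: inj_on_def)
      moreover have "\<forall>j\<in>I. (g(i := x)) j \<in> A j" using g(2) x by auto
      ultimately show ?thesis by blast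
    qed simp
  qed
qed

section \<open>Stable sets of critical graphs\<close>

definition stable :: "('a \<Rightarrow> 'a \<Rightarrow> bool) \<Rightarrow> 'a set \<Rightarrow> bool" where
  "stable h S \<longleftrightarrow> (\<forall>x\<in>S. \<forall>y\<in>S. \<not> h x y)"

lemma stable_subset: "stable h S \<Longrightarrow> T \<subseteq> S \<Longrightarrow> stable h T"
  by (auto simp: stable_def)

text \<open>A clique \<open>z ` Y\<close> with a pendant edge \<open>{y, z y}\<close> at each of its vertices.\<close>

definition net :: "('a \<Rightarrow> 'a \<Rightarrow> bool) \<Rightarrow> 'a set \<Rightarrow> 'a set \<Rightarrow> ('a \<Rightarrow> 'a) \<Rightarrow> bool" where
  "net h V Y z \<longleftrightarrow> Y \<subseteq> V \<and> z ` Y \<subseteq> V \<and> inj_on z Y \<and> z ` Y \<inter> Y = {} \<and>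
     (\<forall>y\<in>Y. \<forall>y'\<in>Y. \<not> h y y' \<and> (h y (z y') \<longleftrightarrow> y = y') \<and> (h (z y) (z y') \<longleftrightarrow> y \<noteq> y'))"

text \<open>Here \<open>h\<close> stands for non-adjacency in \<open>B\<close> or \<open>R\<close>,
  so that its stable sets are cliques there. \<open>avoid\<close> records that deleting a vertex
  does not lower the clique number, and \<open>no_matched_triples\<close> the absence of
  \<open>family_F\<close>; the stability and the edges in it force the two triples to be
  disjoint.\<close>

locale critical_graph =
  fixes h :: "'a \<Rightarrow> 'a \<Rightarrow> bool" and V :: "'a set" and a :: nat
  assumes finite_V: "finite V"
    and sym: "h x y \<Longrightarrow> h y x"
    and irrefl: "\<not> h x x"
    and card_stable_le: "S \<subseteq> V \<Longrightarrow> stable h S \<Longrightarrow> card S \<le> a"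
    and avoid: "v \<in> V \<Longrightarrow> \<exists>S\<subseteq>V. stable h S \<and> card S = a \<and> v \<notin> S"
    and no_matched_triples: "\<lbrakk>{x1, x2, x3, y1, y2, y3} \<subseteq> V; distinct [x1, x2, x3]; distinct [y1, y2, y3];
      stable h {x1, x2, x3}; stable h {y1, y2, y3}; h x1 y1; h x2 y2; h x3 y3\<rbrakk> \<Longrightarrow> False"
begin

definition maxst :: "'a set \<Rightarrow> bool" where
  "maxst S \<longleftrightarrow> S \<subseteq> V \<and> stable h S \<and> card S = a"

lemma maxst_subset: "maxst S \<Longrightarrow> S \<subseteq> V"
  and maxst_stable: "maxst S \<Longrightarrow> stable h S"
  and maxst_card: "maxst S \<Longrightarrow> card S = a"
  and maxst_finite: "maxst S \<Longrightarrow> finite S"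
  using finite_V by (auto simp: maxst_def intro: finite_subset)

lemma maxst_nonadj: "maxst S \<Longrightarrow> x \<in> S \<Longrightarrow> y \<in> S \<Longrightarrow> \<not> h x y"
  using maxst_stable by (auto simp: stable_def)

text \<open>Exchange argument: replacing the neighbours of \<open>S\<close> in \<open>M\<close> by
  \<open>S\<close> yields a stable set, which cannot be larger than \<open>M\<close>.\<close>

lemma card_le_nbrs:
  assumes M: "maxst M" and S: "S \<subseteq> V" "stable h S" "S \<inter> M = {}"
  shows "card S \<le> card {m \<in> M. \<exists>s\<in>S. h s m}"
proof -
  let ?N = "{m \<in> M. \<exists>s\<in>S. h s m}"
  have fin: "finite M" "finite S" using M S finite_V by (auto simp: maxst_finite intro: finite_subset)
  have "stable h (S \<union> (M - ?N))"
    using S(2) maxst_stable[OF M] by (auto simp: stable_def dest: sym)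
  then have "card (S \<union> (M - ?N)) \<le> a"
    using S maxst_subset[OF M] by (intro card_stable_le) auto
  moreover have "card (S \<union> (M - ?N)) = card S + card (M - ?N)"
    using S fin by (intro card_Un_disjoint) auto
  moreover have "card (M - ?N) = card M - card ?N"
    using fin by (intro card_Diff_subset) auto
  moreover have "card ?N \<le> card M" using fin by (intro card_mono) auto
  ultimately show ?thesis using maxst_card[OF M] by linarith
qed

lemma maxst_nbr:
  assumes "maxst M" "x \<in> V" "x \<notin> M"
  shows "\<exists>m\<in>M. h x m"
proof (rule ccontr)
  assume "\<not> ?thesis"
  then have "{m \<in> M. \<exists>s\<in>{x}. h s m} = {}" by auto
  moreover have "card {x} \<le> card {m \<in> M. \<exists>s\<in>{x}. h s m}"
    using assms irrefl by (intro card_le_nbrs) (auto simp: stable_def)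
  ultimately show False by (simp only: card.empty) simp
qed

text \<open>By \<open>card_le_nbrs\<close>, any three vertices of \<open>K - L\<close> satisfy
  Hall's condition for their neighbourhoods in \<open>L\<close>; the resulting matching is the
  forbidden pair of triples.\<close>

lemma maxst_diff_le:
  assumes K: "maxst K" and L: "maxst L"
  shows "card (K - L) \<le> 2"
proof (rule ccontr)
  assume "\<not> card (K - L) \<le> 2"
  then obtain S where S: "S \<subseteq> K - L" "card S = 3"
    by (metis Suc_leI eval_nat_numeral(3) not_le obtain_subset_with_card_n)
  have stS: "stable h T" "T \<subseteq> V" "T \<inter> L = {}" if "T \<subseteq> S" for T
    using that S maxst_stable[OF K] maxst_subset[OF K] by (auto intro: stable_subset)
  have "\<exists>f. inj_on f S \<and> (\<forall>s\<in>S. f s \<in> {m \<in> L. h s m})"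
  proof (rule hall_selection)
    show "finite S" using S by (metis card.infinite zero_neq_numeral)
    show "finite {m \<in> L. h s m}" for s using maxst_finite[OF L] by simp
    fix T assume "T \<subseteq> S"
    moreover have "(\<Union>s\<in>T. {m \<in> L. h s m}) = {m \<in> L. \<exists>s\<in>T. h s m}" by auto
    ultimately show "card T \<le> card (\<Union>s\<in>T. {m \<in> L. h s m})"
      using card_le_nbrs[OF L] stS by simp
  qed
  then obtain f where f: "inj_on f S" "\<And>s. s \<in> S \<Longrightarrow> f s \<in> L" "\<And>s. s \<in> S \<Longrightarrow> h s (f s)" by blast
  obtain x1 x2 x3 where x: "S = {x1, x2, x3}" "distinct [x1, x2, x3]"
    using S(2) by (auto simp: card_3_iff)
  have "stable h {f x1, f x2, f x3}"
    using f(2) x maxst_stable[OF L] by (auto intro: stable_subset)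
  moreover have "distinct [f x1, f x2, f x3]"
    using f(1) x by (auto simp: inj_on_def)
  moreover have "{x1, x2, x3, f x1, f x2, f x3} \<subseteq> V"
    using x stS(2)[of S] f(2) maxst_subset[OF L] by auto
  ultimately show False
    using no_matched_triples[of x1 x2 x3 "f x1" "f x2" "f x3"] x stS(1)[of S] f(3) by auto
qed

text \<open>
  As in Hajnal's inequality: \<open>L \<inter> M - K\<close> has its neighbours in \<open>K\<close> inside \<open>K - (L \<union> M)\<close>, so
  \<open>|L \<inter> M|\<close> is at most \<open>|K|\<close> minus the cardinality below, while \<open>|L - M| \<le> 2\<close>.
\<close>

lemma maxst_symdiff_le:
  assumes K: "maxst K" and L: "maxst L" and M: "maxst M"
  shows "card {x \<in> K. (x \<in> L) \<noteq> (x \<in> M)} \<le> 2"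
proof -
  have fin: "finite K" "finite L" "finite M" using assms maxst_finite by auto
  have "card ((L \<inter> M) - K) \<le> card {m \<in> K. \<exists>s\<in>(L \<inter> M) - K. h s m}"
    using maxst_subset[OF L] maxst_stable[OF L]
    by (intro card_le_nbrs K) (auto intro: stable_subset)
  also have "\<dots> \<le> card (K - (L \<union> M))"
    using fin maxst_nonadj[OF L] maxst_nonadj[OF M] by (intro card_mono) auto
  finally have 1: "card ((L \<inter> M) - K) \<le> card (K - (L \<union> M))" .
  have 2: "card (L - M) \<le> 2" using L M by (rule maxst_diff_le)
  have 3: "card L = card (L - M) + card (L \<inter> M)"
    using fin by (metis add.commute card_Int_Diff)
  have 4: "card (L \<inter> M) = card ((L \<inter> M) - K) + card (L \<inter> M \<inter> K)"
    using fin by (metis add.commute card_Int_Diff finite_Int)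
  \<comment> \<open>\<open>K\<close> splits into vertices in both, in neither and in exactly one of
    \<open>L\<close> and \<open>M\<close>. As \<open>card L = card K\<close>, the first two parts
    account for all but at most \<open>card (L - M)\<close> vertices.\<close>
  have "K = (L \<inter> M \<inter> K) \<union> ((K - (L \<union> M)) \<union> {x \<in> K. (x \<in> L) \<noteq> (x \<in> M)})" by auto
  then have "card K = card \<dots>" by simp
  also have "\<dots> = card (L \<inter> M \<inter> K) + (card (K - (L \<union> M)) + card {x \<in> K. (x \<in> L) \<noteq> (x \<in> M)})"
    using fin by (subst card_Un_disjoint; (subst card_Un_disjoint)?) auto
  finally show ?thesis
    using 1 2 3 4 maxst_card[OF K] maxst_card[OF L] by linarith
qed

end

section \<open>Nets\<close>

context critical_graph
begin

section \<open>Existence of nets\<close>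

lemma maxst_diff_card:
  assumes "maxst K" "maxst L"
  shows "card (L - K) = card (K - L)"
  using assms by (simp add: card_Diff_subset_Int maxst_finite maxst_card Int_commute)

lemma maxst_third:
  assumes a: "3 \<le> a" and K: "maxst K"
  shows "\<exists>u\<in>K. u \<noteq> s \<and> u \<noteq> t"
proof (rule ccontr)
  assume "\<not> ?thesis"
  then have "card K \<le> card {s, t}" by (intro card_mono) auto
  also have "\<dots> \<le> 2" by (simp add: card_insert_if)
  finally show False using a maxst_card[OF K] by simp
qed

text \<open>Stability of the swapped set keeps \<open>z y\<close> away from \<open>Y - {y}\<close>,
  so maximality of \<open>Y\<close> makes it adjacent to \<open>y\<close>. Two non-adjacent
  \<open>z y\<close>, \<open>z y'\<close> would, with a third vertex of \<open>Y\<close>, form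
  matched triples.\<close>

lemma net_if_swaps:
  assumes a: "3 \<le> a" and Y: "maxst Y"
    and z: "\<And>y. y \<in> Y \<Longrightarrow> z y \<in> V - Y" "\<And>y. y \<in> Y \<Longrightarrow> maxst (insert (z y) (Y - {y}))"
  shows "net h V Y z"
proof -
  have nonadj: "\<not> h y' (z y)" if "y \<in> Y" "y' \<in> Y" "y' \<noteq> y" for y y'
    using that maxst_nonadj[OF z(2)[of y]] by auto
  have adj: "h y (z y)" if "y \<in> Y" for y
    using maxst_nbr[OF Y, of "z y"] z(1)[OF that] nonadj that by (metis DiffE sym)
  have inj: "inj_on z Y"
    by (rule inj_onI) (metis adj nonadj)
  have clique: "h (z y) (z y')" if yy: "y \<in> Y" "y' \<in> Y" "y \<noteq> y'" for y y'
  proof (rule ccontr)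
    assume nh: "\<not> h (z y) (z y')"
    obtain y0 where y0: "y0 \<in> Y" "y0 \<noteq> y" "y0 \<noteq> y'" using maxst_third[OF a Y] by blast
    show False
    proof (rule no_matched_triples[of "z y0" y y' y0 "z y" "z y'"])
      show "{z y0, y, y', y0, z y, z y'} \<subseteq> V" using yy y0 z(1) maxst_subset[OF Y] by auto
      show "distinct [z y0, y, y']" using yy y0 z(1)[of y0] by auto
      show "distinct [y0, z y, z y']" using yy y0 z(1)[of y] z(1)[of y'] inj by (auto dest: inj_onD)
      show "stable h {z y0, y, y'}"
        using maxst_stable[OF z(2)[OF y0(1)]] yy y0 by (auto intro: stable_subset)
      show "stable h {y0, z y, z y'}"
        using nonadj[of y y0] nonadj[of y' y0] yy y0 nh irrefl by (auto simp: stable_def dest: sym)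
      show "h (z y0) y0" using adj[OF y0(1)] by (rule sym)
    qed (use adj yy in auto)
  qed
  show ?thesis
    unfolding net_def using maxst_subset[OF Y] z(1) inj adj nonadj clique irrefl maxst_nonadj[OF Y]
    by (intro conjI ballI) (auto 4 3, metis)
qed

lemma avoid_maxst: "v \<in> V \<Longrightarrow> \<exists>L. maxst L \<and> v \<notin> L"
  using avoid[of v] by (auto simp: maxst_def)

text \<open>
  The sets \<open>K - L\<close>, for maximum stable \<open>L\<close>, cover \<open>K\<close>, have at most two elements and pairwise
  symmetric differences of size at most two. If the singleton \<open>{y}\<close> is not among them, they
  contain a star of pairs.
\<close>

lemma star_exists:
  assumes a: "3 \<le> a" and K: "maxst K"
    and y: "y \<in> K" "\<And>z. z \<in> V - K \<Longrightarrow> \<not> maxst (insert z (K - {y}))"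
  shows "\<exists>c\<in>K. \<forall>w\<in>K - {c}. \<exists>L. maxst L \<and> K - L = {w, c}"
proof -
  note finK = maxst_finite[OF K] and third = maxst_third[OF a K] and diff_card = maxst_diff_card[OF K]
  have Ksub: "x \<in> V" if "x \<in> K" for x using that maxst_subset[OF K] by blast
  obtain Ly where Ly: "maxst Ly" "y \<notin> Ly" using avoid_maxst Ksub y by blast
  \<comment> \<open>If \<open>K - Ly\<close> were \<open>{y}\<close>, then \<open>Ly\<close> would
    arise from \<open>K\<close> by a swap at \<open>y\<close>, which is excluded.\<close>
  have "\<exists>x. x \<noteq> y \<and> K - Ly = {y, x}"
  proof -
    have "K - Ly \<noteq> {y}"
    proof
      assume e: "K - Ly = {y}"
      then have "card (Ly - K) = 1" using diff_card[OF Ly(1)] by simp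
      then obtain z where z: "Ly - K = {z}" by (auto simp: card_1_singleton_iff)
      then have "Ly = insert z (K - {y})" using e by auto
      moreover have "z \<in> V - K" using z maxst_subset[OF Ly(1)] by auto
      ultimately show False using y(2) Ly(1) by auto
    qed
    then obtain x where x: "x \<in> K - Ly" "x \<noteq> y" using y(1) Ly(2) by blast
    have "{y, x} = K - Ly"
      using x y(1) Ly(2) maxst_diff_le[OF K Ly(1)] finK by (intro card_seteq) auto
    then show ?thesis using x by blast
  qed
  then obtain x where x: "x \<noteq> y" "K - Ly = {y, x}" by blast
  have xK: "x \<in> K" using x(2) by blast
  \<comment> \<open>A set \<open>L\<close> that misses \<open>u\<close> but neither \<open>x\<close>
    nor \<open>y\<close> would differ from \<open>Ly\<close> at all of \<open>u\<close>,
    \<open>x\<close>, \<open>y\<close>.\<close>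
  have D: "\<exists>L c. maxst L \<and> c \<in> {x, y} \<and> K - L = {u, c}" if u: "u \<in> K" "u \<noteq> x" "u \<noteq> y" for u
  proof -
    obtain L where L: "maxst L" "u \<notin> L" using avoid_maxst Ksub u by blast
    have "x \<notin> L \<or> y \<notin> L"
    proof (rule ccontr)
      assume "\<not> ?thesis"
      then have "{u, x, y} \<subseteq> {w \<in> K. (w \<in> Ly) \<noteq> (w \<in> L)}" using u L x by auto
      then have "card {u, x, y} \<le> 2"
        using finK by (intro le_trans[OF card_mono maxst_symdiff_le[OF K Ly(1) L(1)]]) auto
      then show False using u x by auto
    qed
    then obtain c where c: "c \<in> {x, y}" "c \<notin> L" by auto
    have "c \<in> K" "u \<noteq> c" using c(1) y(1) xK u by auto
    then have "{u, c} = K - L"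
      using c(2) u(1) L(2) maxst_diff_le[OF K L(1)] finK by (intro card_seteq) simp_all
    then show ?thesis using c L by blast
  qed
  obtain u where u: "u \<in> K" "u \<noteq> x" "u \<noteq> y" using third by blast
  \<comment> \<open>One further vertex \<open>u\<close> decides which of \<open>x\<close>,
    \<open>y\<close> is the centre; \<open>Ly\<close> then serves the other of the two.\<close>
  obtain Lu c where c: "maxst Lu" "c \<in> {x, y}" "K - Lu = {u, c}" using D[OF u] by blast
  have cK: "c \<in> K" using c by blast
  have star: "\<exists>L. maxst L \<and> K - L = {w, c}" if w: "w \<in> K - {c}" for w
  proof (cases "w = u \<or> w = x \<or> w = y")
    case True
    then consider "w = u" | "{w, c} = {y, x}" using w c(2) by auto
    then show ?thesis
    proof cases
      case 1
      then show ?thesis using c(1,3) by (intro exI[of _ Lu]) simp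
    next
      case 2
      then show ?thesis using Ly(1) x(2) by (intro exI[of _ Ly]) simp
    qed
  next
    case False
    obtain L d where L: "maxst L" "d \<in> {x, y}" "K - L = {w, d}" using D[of w] w False by blast
    \<comment> \<open>Different centres would make the pairs \<open>{w, d}\<close> and
      \<open>{u, c}\<close> disjoint, and their symmetric difference too large.\<close>
    have "d = c"
    proof (rule ccontr)
      assume "d \<noteq> c"
      have ne: "w \<noteq> d" "u \<noteq> d" "w \<noteq> u" "w \<noteq> c" "u \<noteq> c" "c \<noteq> d"
        using L(2) c(2) w u False \<open>d \<noteq> c\<close> by auto
      have mL: "v \<in> L \<longleftrightarrow> v \<noteq> w \<and> v \<noteq> d" if "v \<in> K" for v using L(3) that by blast
      have mLu: "v \<in> Lu \<longleftrightarrow> v \<noteq> u \<and> v \<noteq> c" if "v \<in> K" for v using c(3) that by blast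
      have "{w, c, u} \<subseteq> {v \<in> K. (v \<in> L) \<noteq> (v \<in> Lu)}"
        using w cK u(1) ne ne[symmetric] by (simp add: mL mLu)
      then have "card {w, c, u} \<le> card {v \<in> K. (v \<in> L) \<noteq> (v \<in> Lu)}"
        using finK by (intro card_mono) auto
      also have "\<dots> \<le> 2" by (rule maxst_symdiff_le[OF K L(1) c(1)])
      finally show False using ne by simp
    qed
    then show ?thesis using L by blast
  qed
  then show ?thesis using cK by blast
qed

text \<open>
  For a leaf \<open>w\<close> with \<open>K - L = {w, c}\<close>, one of the two elements of \<open>L - K\<close> is a neighbour of \<open>w\<close>;
  the other one does not depend on \<open>w\<close> and replaces the centre \<open>c\<close> in the required set.
\<close>

lemma swaps_if_star:
  assumes a: "3 \<le> a" and K: "maxst K" and cK: "c \<in> K"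
    and star: "\<And>w. w \<in> K - {c} \<Longrightarrow> \<exists>L. maxst L \<and> K - L = {w, c}"
  shows "\<exists>Y. maxst Y \<and> (\<forall>y\<in>Y. \<exists>z. z \<in> V - Y \<and> maxst (insert z (Y - {y})))"
proof -
  note finK = maxst_finite[OF K] and third = maxst_third[OF a K] and diff_card = maxst_diff_card[OF K]
  have Ksub: "x \<in> V" if "x \<in> K" for x using that maxst_subset[OF K] by blast
  define W where "W = K - {c}"
  obtain L where L: "\<And>w. w \<in> W \<Longrightarrow> maxst (L w)" "\<And>w. w \<in> W \<Longrightarrow> K - L w = {w, c}"
    using star unfolding W_def by metis
  have WK: "w \<in> K" "w \<noteq> c" "w \<notin> L w" "c \<notin> L w" if "w \<in> W" for w
    using that L(2)[OF that] by (auto simp: W_def)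
  have WL: "w' \<in> L w" if "w \<in> W" "w' \<in> W" "w' \<noteq> w" for w w'
    using that L(2)[of w] WK[of w'] by blast
  have "\<exists>q\<in>L w. h w q" if "w \<in> W" for w
    using maxst_nbr[OF L(1)[OF that]] WK[OF that] Ksub by blast
  then obtain q where q: "\<And>w. w \<in> W \<Longrightarrow> q w \<in> L w" "\<And>w. w \<in> W \<Longrightarrow> h w (q w)" by metis
  have qK: "q w \<notin> K" if "w \<in> W" for w
    using q(2)[OF that] maxst_nonadj[OF K] WK(1)[OF that] by blast
  \<comment> \<open>\<open>L w'\<close> contains \<open>w\<close>, a neighbour of
    \<open>q w\<close>.\<close>
  have qL: "q w \<notin> L w'" if "w \<in> W" "w' \<in> W" "w' \<noteq> w" for w w'
    using q(2)[OF that(1)] WL[of w' w] that maxst_nonadj[OF L(1)[OF that(2)]] by blast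
  have "\<exists>p. p \<noteq> q w \<and> L w - K = {q w, p}" if "w \<in> W" for w
  proof -
    have "card (L w - K) = 2"
      using diff_card[OF L(1)[OF that]] L(2)[OF that] WK[OF that] by simp
    then obtain s t where st: "s \<noteq> t" "L w - K = {s, t}" by (auto simp: card_2_iff)
    have "q w \<in> L w - K" using q(1)[OF that] qK[OF that] by blast
    then consider "q w = s" | "q w = t" using st(2) by blast
    then show ?thesis
    proof cases
      case 1
      then show ?thesis using st by (intro exI[of _ t]) simp
    next
      case 2
      then show ?thesis using st by (intro exI[of _ s]) (simp add: insert_commute)
    qed
  qed
  then obtain p where p: "\<And>w. w \<in> W \<Longrightarrow> p w \<noteq> q w" "\<And>w. w \<in> W \<Longrightarrow> L w - K = {q w, p w}" by metis
  have p_eq: "p w' = p w" if w: "w \<in> W" "w' \<in> W" "w' \<noteq> w" for w w'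
  proof -
    \<comment> \<open>The vertices \<open>w\<close> and \<open>q w'\<close> exhaust the two places
      in \<open>L w' - L w\<close>, so \<open>p w'\<close> must lie in \<open>L w\<close>.\<close>
    have "{w, q w'} = L w' - L w"
      using w WL[of w' w] WK[of w] q(1)[of w'] qL[of w' w] qK[of w'] maxst_diff_le[OF L(1) L(1), of w' w]
        maxst_finite[OF L(1)] by (intro card_seteq) (auto simp: card_insert_if)
    moreover have "p w' \<in> L w'" "p w' \<notin> K" using p(2)[OF w(2)] by auto
    moreover have "p w' \<notin> {w, q w'}" using p(1)[OF w(2)] WK(1)[OF w(1)] \<open>p w' \<notin> K\<close> by blast
    ultimately have "p w' \<in> L w - K" by simp
    then have "p w' \<in> {q w, p w}" using p(2)[OF w(1)] by simp
    moreover have "q w \<noteq> p w'" using qL[OF w(1,2,3)] \<open>p w' \<in> L w'\<close> by auto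
    ultimately show ?thesis by auto
  qed
  obtain w0 where w0: "w0 \<in> W" using third[of c c] by (auto simp: W_def)
  define P where "P = p w0"
  have pP: "p w = P" if "w \<in> W" for w using p_eq[of w0 w] that w0 by (auto simp: P_def)
  have LP: "L w - K = {q w, P}" "P \<noteq> q w" "P \<in> L w" "P \<notin> K" if "w \<in> W" for w
    using p[OF that] pP[OF that] by auto
  have PK: "P \<notin> K" "P \<in> V" using LP[OF w0] maxst_subset[OF L(1)[OF w0]] by auto
  have Pw: "\<not> h P w" if "w \<in> W" for w
  proof -
    obtain w' where w': "w' \<in> W" "w' \<noteq> w" using third[of c w] by (auto simp: W_def)
    then show ?thesis using maxst_nonadj[OF L(1)[OF w'(1)] LP(3)[OF w'(1)]] WL[OF w'(1) that] by blast
  qed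
  \<comment> \<open>The set sought is \<open>K\<close> with the centre \<open>c\<close> replaced by
    the common vertex \<open>P\<close>. Swapping \<open>P\<close> back for \<open>c\<close> gives
    \<open>K\<close>, and swapping \<open>y\<close> for \<open>q y\<close> gives
    \<open>L y\<close>.\<close>
  have Y: "maxst (insert P W)"
  proof -
    have "stable h (insert P W)"
      using Pw irrefl maxst_nonadj[OF K] WK(1) unfolding stable_def by (blast dest: sym)
    moreover have "card (insert P W) = a"
      using PK finK cK maxst_card[OF K] a by (simp add: W_def card_insert_if)
    ultimately show ?thesis using PK Ksub WK(1) by (auto simp: maxst_def)
  qed
  have "\<exists>z. z \<in> V - insert P W \<and> maxst (insert z (insert P W - {y}))" if "y \<in> insert P W" for y
  proof (cases "y = P")
    case True
    have "insert c (insert P W - {P}) = K" using cK PK by (auto simp: W_def)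
    then show ?thesis using True K cK Ksub PK by (intro exI[of _ c]) (auto simp: W_def)
  next
    case False
    then have yW: "y \<in> W" using that by auto
    have "insert (q y) (insert P W - {y}) = L y"
      using LP[OF yW] L(2)[OF yW] yW PK by (auto simp: W_def)
    moreover have "q y \<in> V - insert P W"
      using LP(2)[OF yW] qK[OF yW] WK(1) q(1)[OF yW] maxst_subset[OF L(1)[OF yW]] by auto
    ultimately show ?thesis using L(1)[OF yW] by metis
  qed
  then show ?thesis using Y by blast
qed

text \<open>A maximum stable set that lacks a swap at some vertex yields a star, and the star yields
  another set with all swaps.\<close>

lemma swap_base_exists:
  assumes a: "3 \<le> a" and V: "V \<noteq> {}"
  shows "\<exists>Y. maxst Y \<and> (\<forall>y\<in>Y. \<exists>z. z \<in> V - Y \<and> maxst (insert z (Y - {y})))"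
proof -
  obtain K where K: "maxst K" using V avoid_maxst by blast
  show ?thesis
  proof (cases "\<forall>y\<in>K. \<exists>z. z \<in> V - K \<and> maxst (insert z (K - {y}))")
    case True
    then show ?thesis using K by blast
  next
    case False
    then obtain c where "c \<in> K" "\<forall>w\<in>K - {c}. \<exists>L. maxst L \<and> K - L = {w, c}"
      using star_exists[OF a K] by blast
    then show ?thesis using swaps_if_star[OF a K] by blast
  qed
qed

lemma net_exists:
  assumes "3 \<le> a" "V \<noteq> {}"
  shows "\<exists>Y z. maxst Y \<and> net h V Y z"
proof -
  obtain Y where Y: "maxst Y" "\<forall>y\<in>Y. \<exists>z. z \<in> V - Y \<and> maxst (insert z (Y - {y}))"
    using swap_base_exists[OF assms] by blast
  then obtain z where "\<And>y. y \<in> Y \<Longrightarrow> z y \<in> V - Y" "\<And>y. y \<in> Y \<Longrightarrow> maxst (insert (z y) (Y - {y}))"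
    by metis
  then show ?thesis using net_if_swaps[OF assms(1) Y(1)] Y(1) by blast
qed

end

lemma netD:
  assumes "net h V Y z"
  shows net_subset: "Y \<subseteq> V" "z ` Y \<subseteq> V"
    and net_inj: "inj_on z Y"
    and net_disjoint: "z ` Y \<inter> Y = {}"
    and net_stable: "\<And>y y'. y \<in> Y \<Longrightarrow> y' \<in> Y \<Longrightarrow> \<not> h y y'"
    and net_match: "\<And>y y'. y \<in> Y \<Longrightarrow> y' \<in> Y \<Longrightarrow> h y (z y') \<longleftrightarrow> y = y'"
    and net_clique: "\<And>y y'. y \<in> Y \<Longrightarrow> y' \<in> Y \<Longrightarrow> h (z y) (z y') \<longleftrightarrow> y \<noteq> y'"
  using assms unfolding net_def by auto

section \<open>Maximum stable sets and outside vertices relative to a net\<close>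

locale net_graph = critical_graph +
  fixes Y :: "'a set" and z :: "'a \<Rightarrow> 'a"
  assumes a_ge_3: "3 \<le> a" and Y: "maxst Y" and net: "net h V Y z"
begin

lemmas Y_third = maxst_third[OF a_ge_3 Y]

lemma Y_two_others: "\<exists>s\<in>Y. \<exists>t\<in>Y. s \<noteq> t \<and> s \<noteq> i \<and> t \<noteq> i"
proof -
  obtain s where s: "s \<in> Y" "s \<noteq> i" using Y_third by blast
  obtain t where "t \<in> Y" "t \<noteq> i" "t \<noteq> s" using Y_third by blast
  then show ?thesis using s by blast
qed

lemma z_nin: "y \<in> Y \<Longrightarrow> z y \<notin> Y"
  using net_disjoint[OF net] by blast

lemma swap_maxst:
  assumes y: "y \<in> Y"
  shows "maxst (insert (z y) (Y - {y}))"
proof -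
  have "stable h (insert (z y) (Y - {y}))"
    using y net_stable[OF net] net_match[OF net _ y] irrefl unfolding stable_def
    by (blast dest: sym)
  moreover have "card (insert (z y) (Y - {y})) = a"
    using y z_nin[OF y] maxst_finite[OF Y] maxst_card[OF Y] a_ge_3 by (simp add: card_insert_if)
  ultimately show ?thesis using net_subset[OF net] y by (auto simp: maxst_def)
qed

text \<open>For a third vertex \<open>u\<close> of \<open>Y\<close>, either \<open>u\<close> is
  missed too, contradicting \<open>maxst_diff_le\<close>, or \<open>L\<close> and the swap at
  \<open>u\<close> differ at \<open>s\<close>, \<open>t\<close> and \<open>u\<close>, contradicting
  \<open>maxst_symdiff_le\<close>.\<close>

lemma net_diff_le_1:
  assumes L: "maxst L" and s: "s \<in> Y - L" and t: "t \<in> Y - L"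
  shows "s = t"
proof (rule ccontr)
  assume st: "s \<noteq> t"
  obtain u where u: "u \<in> Y" "u \<noteq> s" "u \<noteq> t" using Y_third by blast
  have card3: "card {s, t, u} = 3" using st u by simp
  show False
  proof (cases "u \<in> L")
    case True
    have "{s, t, u} \<subseteq> {x \<in> Y. (x \<in> L) \<noteq> (x \<in> insert (z u) (Y - {u}))}"
      using s t u True z_nin[of u] by auto
    then have "card {s, t, u} \<le> 2"
      using maxst_finite[OF Y]
      by (intro le_trans[OF card_mono maxst_symdiff_le[OF Y L swap_maxst[OF u(1)]]]) auto
    then show False using card3 by simp
  next
    case False
    then have "{s, t, u} \<subseteq> Y - L" using s t u by blast
    then have "card {s, t, u} \<le> 2"
      using maxst_finite[OF Y] by (intro le_trans[OF card_mono maxst_diff_le[OF Y L]]) auto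
    then show False using card3 by simp
  qed
qed

end

text \<open>\<open>v\<close> is later the only vertex outside the net. \<open>v_clique\<close> will
  hold because the net's clique is a maximum stable set of the other graph and cannot be enlarged by
  \<open>v\<close>.\<close>

locale net_graph_attached = net_graph +
  fixes v :: 'a
  assumes v_V: "v \<in> V" and v_Y: "v \<notin> Y" and v_Z: "v \<notin> z ` Y"
    and v_clique: "\<exists>y\<in>Y. \<not> h v (z y)"
begin

text \<open>If \<open>v\<close> missed \<open>z i\<close> as well, maximality of the swap at
  \<open>i\<close> would give a neighbour \<open>k\<close> of \<open>v\<close> in \<open>Y\<close>,
  and \<open>v, z i, j\<close> would be matched to \<open>k, i, z j\<close>.\<close>

lemma attached_to_clique:
  assumes j: "j \<in> Y" "\<not> h v j" and i: "i \<in> Y" "i \<noteq> j"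
  shows "h v (z i)"
proof (rule ccontr)
  assume n: "\<not> h v (z i)"
  have "v \<notin> insert (z i) (Y - {i})" using v_Y v_Z i by auto
  then obtain k where "k \<in> insert (z i) (Y - {i})" "h v k"
    using maxst_nbr[OF swap_maxst[OF i(1)] v_V] by blast
  then have k: "k \<in> Y" "k \<noteq> i" "h v k" using n by auto
  have kj: "k \<noteq> j" using k j by blast
  show False
  proof (rule no_matched_triples[of v "z i" j k i "z j"])
    show "{v, z i, j, k, i, z j} \<subseteq> V" using v_V i j k net_subset[OF net] by auto
    show "distinct [v, z i, j]" using v_Y v_Z i j z_nin[of i] by auto
    show "distinct [k, i, z j]" using k i j z_nin[of j] by auto
    have "\<not> h j (z i)" "\<not> h i (z j)" "\<not> h k (z j)" "\<not> h k i"
      using i j k kj net_match[OF net] net_stable[OF net] by auto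
    then show "stable h {v, z i, j}" "stable h {k, i, z j}"
      using n j(2) irrefl by (auto simp: stable_def dest: sym)
    show "h v k" by (rule k)
    show "h (z i) i" using i net_match[OF net i(1) i(1)] by (simp add: sym)
    show "h j (z j)" using j net_match[OF net j(1) j(1)] by simp
  qed
qed

lemma attached_cases:
  obtains (full) "\<And>y. y \<in> Y \<Longrightarrow> h v y"
  | (punctured) j where "j \<in> Y" "\<And>y. y \<in> Y \<Longrightarrow> h v y \<longleftrightarrow> y \<noteq> j" "\<And>y. y \<in> Y \<Longrightarrow> h v (z y) \<longleftrightarrow> y \<noteq> j"
proof (cases "\<forall>y\<in>Y. h v y")
  case False
  then obtain j where j: "j \<in> Y" "\<not> h v j" by blast
  \<comment> \<open>All other clique vertices are neighbours of \<open>v\<close>, so the one granted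
    by \<open>v_clique\<close> is \<open>z j\<close>. A second non-neighbour of \<open>v\<close> in
    \<open>Y\<close> would force the edge from \<open>v\<close> to \<open>z j\<close>.\<close>
  have zj: "\<not> h v (z j)" using v_clique attached_to_clique[OF j] by blast
  have "h v y" if "y \<in> Y" "y \<noteq> j" for y
    using attached_to_clique[of y j] zj that j by blast
  then have "\<And>y. y \<in> Y \<Longrightarrow> h v y \<longleftrightarrow> y \<noteq> j" using j by blast
  moreover have "\<And>y. y \<in> Y \<Longrightarrow> h v (z y) \<longleftrightarrow> y \<noteq> j"
    using attached_to_clique[OF j] zj by blast
  ultimately show ?thesis using punctured j by blast
qed (use full in blast)

lemma nonadj_unique:
  assumes "s \<in> Y" "\<not> h v s" "t \<in> Y" "\<not> h v t"
  shows "s = t"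
  using attached_cases assms by metis

text \<open>By \<open>net_diff_le_1\<close>, \<open>L\<close> exchanges at most one \<open>i\<close>
  for some \<open>w\<close>. Here \<open>w = v\<close> would give \<open>v\<close> two
  non-neighbours in \<open>Y\<close>, and \<open>w = z k\<close> with \<open>k\<close> other than
  \<open>i\<close> would leave the edge from \<open>k\<close> to \<open>z k\<close> inside
  \<open>L\<close>.\<close>

lemma maxst_cases:
  assumes V: "V = insert v (Y \<union> z ` Y)" and L: "maxst L"
  obtains "L = Y" | i where "i \<in> Y" "L = insert (z i) (Y - {i})"
proof (cases "Y \<subseteq> L")
  case True
  then have "Y = L"
    using maxst_finite[OF L] maxst_card[OF L] maxst_card[OF Y] by (intro card_subset_eq) auto
  then show ?thesis using that by blast
next
  case False
  then obtain i where i: "i \<in> Y" "i \<notin> L" by blast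
  have YL: "Y - L = {i}" using net_diff_le_1[OF L] i by blast
  then have "card (L - Y) = 1" using maxst_diff_card[OF Y L] by simp
  then obtain w where w: "L - Y = {w}" by (auto simp: card_1_singleton_iff)
  have Leq: "L = insert w (Y - {i})" using w YL by blast
  have "w \<in> V" "w \<notin> Y" using w maxst_subset[OF L] by blast+
  then consider "w = v" | k where "k \<in> Y" "w = z k" using V by blast
  then show ?thesis
  proof cases
    case 1
    obtain s where s: "s \<in> Y" "s \<noteq> i" using Y_third by blast
    obtain t where t: "t \<in> Y" "t \<noteq> i" "t \<noteq> s" using Y_third by blast
    have "\<not> h v s" "\<not> h v t" using maxst_nonadj[OF L, of v] Leq 1 s t by auto
    then show ?thesis using nonadj_unique s t by blast
  next
    case 2
    have "h k (z k)" using 2 net_match[OF net] by blast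
    then have "k \<notin> L" using maxst_nonadj[OF L, of k w] Leq 2 by auto
    then have "k = i" using Leq 2 by blast
    then show ?thesis using that(2) Leq 2 by blast
  qed
qed

end

section \<open>Edge-disjoint pairs\<close>

definition net_with_apex :: "('a \<Rightarrow> 'a \<Rightarrow> bool) \<Rightarrow> 'a set \<Rightarrow> 'a set \<Rightarrow> ('a \<Rightarrow> 'a) \<Rightarrow> 'a \<Rightarrow> bool" where
  "net_with_apex h V Y z v \<longleftrightarrow> net h V Y z \<and> 3 \<le> card Y \<and> v \<in> V \<and> v \<notin> Y \<and> v \<notin> z ` Y"

text \<open>
  \<open>P0\<close> is the net with clique $b_1, a_3, a_2$ and pendants $c, b_2, b_3$, together with the apex
  $a_1$. The complements of \<open>P0\<close>, \<open>P1\<close>, \<open>P2\<close> are the net with clique $b_1, b_2, b_3$ and pendants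
  $a_1, a_2, a_3$, together with an apex $c$ adjacent to all pendants, not to $b_1$, and to
  two, one or none of $b_2, b_3$. Larger nets contain these.
\<close>

definition contains_P0 :: "('a \<Rightarrow> 'a \<Rightarrow> bool) \<Rightarrow> 'a set \<Rightarrow> bool" where
  "contains_P0 h V \<longleftrightarrow> (\<exists>Y z v i. net_with_apex h V Y z v \<and> i \<in> Y \<and>
     (\<forall>y\<in>Y. (h v y \<longleftrightarrow> y \<noteq> i) \<and> (h v (z y) \<longleftrightarrow> y \<noteq> i)))"

definition contains_P_compl :: "('a \<Rightarrow> 'a \<Rightarrow> bool) \<Rightarrow> 'a set \<Rightarrow> bool" where
  "contains_P_compl h V \<longleftrightarrow> (\<exists>Y z v i. net_with_apex h V Y z v \<and> i \<in> Y \<and>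
     (\<forall>y\<in>Y. h v y) \<and> \<not> h v (z i))"

definition contains_C5 :: "('a \<Rightarrow> 'a \<Rightarrow> bool) \<Rightarrow> 'a set \<Rightarrow> bool" where
  "contains_C5 h V \<longleftrightarrow> (\<exists>x0 x1 x2 x3 x4. distinct [x0, x1, x2, x3, x4] \<and> {x0, x1, x2, x3, x4} \<subseteq> V \<and>
     h x0 x1 \<and> h x1 x2 \<and> h x2 x3 \<and> h x3 x4 \<and> h x4 x0 \<and>
     \<not> h x0 x2 \<and> \<not> h x1 x3 \<and> \<not> h x2 x4 \<and> \<not> h x3 x0 \<and> \<not> h x4 x1)"

context net_graph_attached
begin

lemma apex: "net_with_apex h V Y z v"
  using net a_ge_3 maxst_card[OF Y] v_V v_Y v_Z by (simp add: net_with_apex_def)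

text \<open>The cycle is \<open>v, s, z s, z t, t\<close> for any two vertices \<open>s\<close>,
  \<open>t\<close> of \<open>Y\<close>.\<close>

lemma contains_C5_if_full:
  assumes full: "\<And>y. y \<in> Y \<Longrightarrow> h v y \<and> \<not> h v (z y)"
  shows "contains_C5 h V"
proof -
  obtain s where s: "s \<in> Y" using Y_third by blast
  obtain t where t: "t \<in> Y" "t \<noteq> s" using Y_third by blast
  have "h v s" "h s (z s)" "h (z s) (z t)" "h (z t) t" "h t v"
    "\<not> h v (z s)" "\<not> h s (z t)" "\<not> h (z s) t" "\<not> h (z t) v" "\<not> h t s"
    using full s t net_match[OF net] net_clique[OF net] net_stable[OF net] by (blast dest: sym)+
  moreover have "distinct [v, s, z s, z t, t]"
    using s t v_Y v_Z z_nin[of s] z_nin[of t] net_inj[OF net] by (auto dest: inj_onD)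
  moreover have "{v, s, z s, z t, t} \<subseteq> V" using s t v_V net_subset[OF net] by auto
  ultimately show ?thesis unfolding contains_C5_def by blast
qed

text \<open>The conjunct \<open>h v i\<close> serves to exclude that both graphs of an edge-disjoint
  pair fall under the second alternative only.\<close>

lemma contains_P0_or_P_compl:
  assumes i: "i \<in> Y" "\<not> h v (z i)"
  shows "contains_P0 h V \<or> contains_P_compl h V \<and> h v i"
  using attached_cases
proof cases
  case full
  then show ?thesis using apex i unfolding contains_P_compl_def by blast
next
  case (punctured j)
  then have "j = i" using i by blast
  then show ?thesis using apex punctured unfolding contains_P0_def by blast
qed

end

lemma net_clique_stable:
  assumes net: "net h V Y z" and disj: "\<And>x y. h x y \<Longrightarrow> \<not> k x y" and irrefl: "\<And>x. \<not> k x x"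
  shows "stable k (z ` Y)"
proof -
  have "\<not> k (z y) (z y')" if "y \<in> Y" "y' \<in> Y" for y y'
    using net_clique[OF net that] disj[of "z y" "z y'"] irrefl by (cases "y = y'") auto
  then show ?thesis by (auto simp: stable_def)
qed

text \<open>The clique of a net of \<open>h\<close> has \<open>a\<close> vertices and is stable in
  \<open>k\<close>.\<close>

lemma card_le_of_disjoint_net:
  assumes "critical_graph h V a" "critical_graph k V b" and disj: "\<And>x y. h x y \<Longrightarrow> \<not> k x y"
    and "3 \<le> a" "V \<noteq> {}"
  shows "a \<le> b"
proof -
  interpret H: critical_graph h V a by fact
  interpret K: critical_graph k V b by fact
  obtain Y z where Y: "H.maxst Y" "net h V Y z" using H.net_exists assms(4,5) by blast
  have "card (z ` Y) \<le> b"
    using net_subset(2)[OF Y(2)] net_clique_stable[OF Y(2) disj K.irrefl] by (rule K.card_stable_le[of "z ` Y"])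
  then show ?thesis using card_image[OF net_inj[OF Y(2)]] H.maxst_card[OF Y(1)] by simp
qed

text \<open>
  The nets of the two graphs use all but one vertex each, and the clique of each net is a maximum
  stable set of the other graph; a maximum stable set differs from the stable part of a net by at
  most one swap.
\<close>

lemma large_critical_pair:
  assumes H: "critical_graph h V a" and K: "critical_graph k V b"
    and disj: "\<And>x y. h x y \<Longrightarrow> \<not> k x y" and cardV: "card V = a + b + 1" and a: "3 \<le> a \<or> 3 \<le> b"
  shows "contains_C5 h V \<and> contains_C5 k V \<or> contains_P0 h V \<and> (contains_P0 k V \<or> contains_P_compl k V)
    \<or> contains_P0 k V \<and> contains_P_compl h V"
proof -
  interpret H: critical_graph h V a by fact
  interpret K: critical_graph k V b by fact
  have V: "V \<noteq> {}" using cardV by auto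
  have "a = b" and a3: "3 \<le> a"
    using a card_le_of_disjoint_net[OF H K disj] card_le_of_disjoint_net[OF K H] disj V
    by (force intro: order_antisym)+
  obtain Y z where Y: "H.maxst Y" "net h V Y z" using H.net_exists a3 V by blast
  obtain Y' z' where Y': "K.maxst Y'" "net k V Y' z'" using K.net_exists a3 V \<open>a = b\<close> by blast
  interpret HN: net_graph h V a Y z using a3 Y by unfold_locales auto
  interpret KN: net_graph k V b Y' z' using a3 \<open>a = b\<close> Y' by unfold_locales auto
  have disj': "\<not> h x y" if "k x y" for x y using that disj by blast
  have stZ: "stable k (z ` Y)" using Y(2) disj K.irrefl by (rule net_clique_stable)
  have stZ': "stable h (z' ` Y')" using Y'(2) disj' H.irrefl by (rule net_clique_stable)
  have cardZ: "card (z ` Y) = a" "card (z' ` Y') = a"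
    using card_image net_inj[OF Y(2)] net_inj[OF Y'(2)] H.maxst_card[OF Y(1)] K.maxst_card[OF Y'(1)] \<open>a = b\<close>
    by metis+
  \<comment> \<open>The net has \<open>2 * a\<close> vertices, and
    \<open>card V = 2 * a + 1\<close>.\<close>
  have "card (V - (Y \<union> z ` Y)) = 1"
    using H.finite_V net_subset[OF Y(2)] net_disjoint[OF Y(2)] H.maxst_card[OF Y(1)] H.maxst_finite[OF Y(1)]
      cardZ cardV \<open>a = b\<close> by (subst card_Diff_subset) (auto simp: card_Un_disjoint Int_commute)
  then obtain v where v: "V - (Y \<union> z ` Y) = {v}" by (auto simp: card_1_singleton_iff)
  have "card (V - (Y' \<union> z' ` Y')) = 1"
    using K.finite_V net_subset[OF Y'(2)] net_disjoint[OF Y'(2)] K.maxst_card[OF Y'(1)] K.maxst_finite[OF Y'(1)]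
      cardZ cardV \<open>a = b\<close> by (subst card_Diff_subset) (auto simp: card_Un_disjoint Int_commute)
  then obtain v' where v': "V - (Y' \<union> z' ` Y') = {v'}" by (auto simp: card_1_singleton_iff)
  have vnin: "v \<in> V" "v \<notin> Y" "v \<notin> z ` Y" and vnin': "v' \<in> V" "v' \<notin> Y'" "v' \<notin> z' ` Y'"
    using v v' by blast+
  have "\<exists>y\<in>Y. \<not> h v (z y)"
  proof (rule ccontr)
    assume "\<not> ?thesis"
    then have "stable k (insert v (z ` Y))"
      using stZ disj K.irrefl by (auto simp: stable_def dest: K.sym)
    then have "card (insert v (z ` Y)) \<le> b"
      using vnin net_subset[OF Y(2)] by (intro K.card_stable_le) auto
    then show False using cardZ vnin H.maxst_finite[OF Y(1)] \<open>a = b\<close> by simp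
  qed
  then interpret HA: net_graph_attached h V a Y z v using vnin by unfold_locales auto
  have "\<exists>y\<in>Y'. \<not> k v' (z' y)"
  proof (rule ccontr)
    assume "\<not> ?thesis"
    then have "stable h (insert v' (z' ` Y'))"
      using stZ' disj' H.irrefl by (auto simp: stable_def dest: H.sym)
    then have "card (insert v' (z' ` Y')) \<le> a"
      using vnin' net_subset[OF Y'(2)] by (intro H.card_stable_le) auto
    then show False using cardZ vnin' K.maxst_finite[OF Y'(1)] by simp
  qed
  then interpret KA: net_graph_attached k V b Y' z' v' using vnin' by unfold_locales auto
  have Veq: "V = insert v (Y \<union> z ` Y)" "V = insert v' (Y' \<union> z' ` Y')"
  proof -
    have "A \<subseteq> V \<Longrightarrow> V - A = {x} \<Longrightarrow> V = insert x A" for A x by blast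
    then show "V = insert v (Y \<union> z ` Y)" "V = insert v' (Y' \<union> z' ` Y')"
      using v v' net_subset[OF Y(2)] net_subset[OF Y'(2)] by simp_all
  qed
  have maxZ': "H.maxst (z' ` Y')" and maxZ: "K.maxst (z ` Y)"
    unfolding H.maxst_def K.maxst_def
    using stZ stZ' cardZ \<open>a = b\<close> net_subset[OF Y(2)] net_subset[OF Y'(2)] by simp_all
  \<comment> \<open>Each clique is a maximum stable set of the other graph, so
    \<open>maxst_cases\<close> applies to both.\<close>
  consider (1) "z' ` Y' = Y" "z ` Y = Y'"
    | (2) i' where "z' ` Y' = Y" "i' \<in> Y'" "z ` Y = insert (z' i') (Y' - {i'})"
    | (3) i where "i \<in> Y" "z' ` Y' = insert (z i) (Y - {i})" "z ` Y = Y'"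
    | (4) i i' where "i \<in> Y" "z' ` Y' = insert (z i) (Y - {i})" "i' \<in> Y'" "z ` Y = insert (z' i') (Y' - {i'})"
    by (rule HA.maxst_cases[OF Veq(1) maxZ']; rule KA.maxst_cases[OF Veq(2) maxZ]) blast+
  then show ?thesis
  proof cases
    case 1
    have "v' = v" using v v' 1 by (simp add: Un_commute)
    \<comment> \<open>In the punctured case \<open>v\<close> has two \<open>h\<close>-neighbours
      \<open>z s\<close>, \<open>z t\<close>; these lie in \<open>Y'\<close> and are non-neighbours
      of \<open>v\<close> in \<open>k\<close>, against \<open>nonadj_unique\<close>.\<close>
    have h_full: "h v y" if y: "y \<in> Y" for y
      using HA.attached_cases
    proof cases
      case (punctured j)
      obtain s t where st: "s \<in> Y" "t \<in> Y" "s \<noteq> t" "s \<noteq> j" "t \<noteq> j" using HN.Y_two_others by blast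
      have "h v (z s)" "h v (z t)" using punctured st by blast+
      then have "z s = z t"
        using disj st 1 \<open>v' = v\<close> by (intro KA.nonadj_unique) blast+
      then show ?thesis using net_inj[OF Y(2)] st by (auto dest: inj_onD)
    qed (use y in blast)
    have k_full: "k v y" if y: "y \<in> Y'" for y
      using KA.attached_cases
    proof cases
      case (punctured j)
      obtain s t where st: "s \<in> Y'" "t \<in> Y'" "s \<noteq> t" "s \<noteq> j" "t \<noteq> j" using KN.Y_two_others by blast
      have "k v (z' s)" "k v (z' t)" using punctured st \<open>v' = v\<close> by blast+
      then have "z' s = z' t"
        using disj st 1 by (intro HA.nonadj_unique) blast+
      then show ?thesis using net_inj[OF Y'(2)] st by (auto dest: inj_onD)
    qed (use y \<open>v' = v\<close> in blast)
    have "contains_C5 h V" using h_full k_full 1 disj by (intro HA.contains_C5_if_full) blast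
    moreover have "contains_C5 k V"
      using h_full k_full 1 disj \<open>v' = v\<close> by (intro KA.contains_C5_if_full) blast
    ultimately show ?thesis by blast
  next
    case 2
    then show ?thesis using net_disjoint[OF Y(2)] by blast
  next
    case 3
    then show ?thesis using net_disjoint[OF Y'(2)] by blast
  next
    case (4 i i')
    have "z' i' = z i"
    proof -
      have "z' i' \<in> insert (z i) (Y - {i})" using 4(2,3) by blast
      moreover have "z' i' \<in> z ` Y" using 4(4) by blast
      ultimately show ?thesis using net_disjoint[OF Y(2)] by blast
    qed
    have ki: "k i' (z i)" using net_match[OF Y'(2) 4(3) 4(3)] \<open>z' i' = z i\<close> by simp
    have hi: "h i (z i)" using net_match[OF Y(2) 4(1) 4(1)] by simp
    have ne: "i \<noteq> i'" using ki hi disj by blast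
    have "i' \<notin> z ` Y"
      using 4(3,4) KN.z_nin[OF 4(3)] by auto
    moreover have "i' \<notin> Y" using 4(2,3) ne net_disjoint[OF Y'(2)] by blast
    \<comment> \<open>The two nets share the clique vertex \<open>z i\<close>, and the pendant of
      each at that vertex is the vertex left out by the other.\<close>
    ultimately have "i' = v" using v 4(3) net_subset[OF Y'(2)] by blast
    have "i \<notin> z' ` Y'"
      using 4(1,2) HN.z_nin[OF 4(1)] by auto
    moreover have "i \<notin> Y'" using 4(1,4) ne net_disjoint[OF Y(2)] by blast
    ultimately have "i = v'" using v' 4(1) net_subset[OF Y(2)] by blast
    have "\<not> h v (z i)" using ki disj \<open>i' = v\<close> by blast
    then have "contains_P0 h V \<or> contains_P_compl h V \<and> h v i" by (rule HA.contains_P0_or_P_compl[OF 4(1)])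
    moreover have "\<not> k v' (z' i')" using hi disj \<open>i = v'\<close> \<open>z' i' = z i\<close> by auto
    then have "contains_P0 k V \<or> contains_P_compl k V \<and> k v' i'" by (rule KA.contains_P0_or_P_compl[OF 4(3)])
    \<comment> \<open>Both would be the same edge, between \<open>v\<close> and
      \<open>v'\<close>.\<close>
    moreover have "\<not> (h v i \<and> k v' i')"
      using disj K.sym \<open>i' = v\<close> \<open>i = v'\<close> by blast
    ultimately show ?thesis by blast
  qed
qed

text \<open>As for the Ramsey number R(3,3): neighbours of \<open>v\<close> are pairwise
  non-adjacent and non-neighbours pairwise adjacent, so there are two of each, and excluding
  triangles and stable triples forces a perfect matching between \<open>{u, w}\<close> and
  \<open>{s, t}\<close>.\<close>

lemma contains_C5_of_card_5:
  assumes sym: "\<And>x y. h x y \<Longrightarrow> h y x" and irrefl: "\<And>x. \<not> h x x" and V: "card V = 5"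
    and no_triangle: "\<And>x y z. \<lbrakk>x \<in> V; y \<in> V; z \<in> V; h x y; h y z\<rbrakk> \<Longrightarrow> \<not> h x z"
    and no_triple: "\<And>x y z. \<lbrakk>x \<in> V; y \<in> V; z \<in> V; distinct [x, y, z]; \<not> h x y; \<not> h y z\<rbrakk> \<Longrightarrow> h x z"
  shows "contains_C5 h V"
proof -
  have finV: "finite V" using V by (metis card.infinite zero_neq_numeral)
  obtain v where v: "v \<in> V" using V by fastforce
  define N where "N = {x \<in> V. h v x}"
  define M where "M = {x \<in> V. x \<noteq> v \<and> \<not> h v x}"
  have fin: "finite N" "finite M" using finV by (auto simp: N_def M_def)
  have "card N \<le> 2"
  proof (rule ccontr)
    assume "\<not> card N \<le> 2"
    then obtain S where S: "S \<subseteq> N" "card S = 3"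
      by (metis Suc_leI eval_nat_numeral(3) not_le obtain_subset_with_card_n)
    then obtain x y z where "S = {x, y, z}" "distinct [x, y, z]" by (auto simp: card_3_iff)
    then show False using S v no_triangle no_triple unfolding N_def
      by (metis (no_types, lifting) insertCI mem_Collect_eq subsetD)
  qed
  moreover have "card M \<le> 2"
  proof (rule ccontr)
    assume "\<not> card M \<le> 2"
    then obtain S where S: "S \<subseteq> M" "card S = 3"
      by (metis Suc_leI eval_nat_numeral(3) not_le obtain_subset_with_card_n)
    then obtain x y z where xyz: "S = {x, y, z}" "distinct [x, y, z]" by (auto simp: card_3_iff)
    have "h x y" "h y z" "h x z"
      using S v no_triple[of x v y] no_triple[of y v z] no_triple[of x v z] xyz sym by (auto simp: M_def)
    then show False using no_triangle[of x y z] S xyz by (auto simp: M_def)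
  qed
  moreover have "card N + card M = 4"
  proof -
    have "V - {v} = N \<union> M" using irrefl by (auto simp: N_def M_def)
    moreover have "card (N \<union> M) = card N + card M"
      using fin by (intro card_Un_disjoint) (auto simp: N_def M_def)
    moreover have "card (V - {v}) = 4" using v V by simp
    ultimately show ?thesis by simp
  qed
  ultimately have "card N = 2" "card M = 2" by linarith+
  then obtain u w s t where N: "N = {u, w}" "u \<noteq> w" and M: "M = {s, t}" "s \<noteq> t"
    by (auto simp: card_2_iff)
  have V4: "u \<in> V" "w \<in> V" "s \<in> V" "t \<in> V" and vN: "h v u" "h v w" and vM: "\<not> h v s" "\<not> h v t"
    and ne: "s \<noteq> v" "t \<noteq> v"
    using N M unfolding N_def M_def by blast+
  have dist: "distinct [v, u, w, s, t]"
    using vN vM ne N(2) M(2) irrefl by auto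
  have uw: "\<not> h u w" using no_triangle[of v u w] v V4 vN by blast
  have st: "h s t" using no_triple[of s v t] v V4 vM dist sym by auto
  have s: "h u s \<or> h w s" using no_triple[of u w s] V4 dist uw by auto
  have t: "h u t \<or> h w t" using no_triple[of u w t] V4 dist uw by auto
  have u: "\<not> (h u s \<and> h u t)" using no_triangle[of u s t] V4 st by auto
  have w: "\<not> (h w s \<and> h w t)" using no_triangle[of w s t] V4 st by auto
  have nsym: "\<not> h y x" if "\<not> h x y" for x y using that sym by blast
  consider "h u s" "h w t" "\<not> h u t" "\<not> h w s" | "h u t" "h w s" "\<not> h u s" "\<not> h w t"
    using s t u w by blast
  then show ?thesis
  proof cases
    case 1
    then have "h v u \<and> h u s \<and> h s t \<and> h t w \<and> h w v \<and>
      \<not> h v s \<and> \<not> h u t \<and> \<not> h s w \<and> \<not> h t v \<and> \<not> h w u"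
      using vN vM uw st sym nsym by blast
    moreover have "distinct [v, u, s, t, w]" "{v, u, s, t, w} \<subseteq> V" using dist V4 v by auto
    ultimately show ?thesis unfolding contains_C5_def by blast
  next
    case 2
    then have "h v u \<and> h u t \<and> h t s \<and> h s w \<and> h w v \<and>
      \<not> h v t \<and> \<not> h u s \<and> \<not> h t w \<and> \<not> h s v \<and> \<not> h w u"
      using vN vM uw st sym nsym by blast
    moreover have "distinct [v, u, t, s, w]" "{v, u, t, s, w} \<subseteq> V" using dist V4 v by auto
    ultimately show ?thesis unfolding contains_C5_def by blast
  qed
qed

text \<open>If \<open>a\<close> were at most 1, \<open>h\<close> would be complete on
  \<open>V\<close>, and all of \<open>V\<close> would be stable in \<open>k\<close>.\<close>

lemma two_le_of_disjoint_critical: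
  assumes "critical_graph h V a" "critical_graph k V b" and disj: "\<And>x y. h x y \<Longrightarrow> \<not> k x y"
    and cardV: "card V = a + b + 1"
  shows "2 \<le> a"
proof (rule ccontr)
  interpret H: critical_graph h V a by fact
  interpret K: critical_graph k V b by fact
  assume "\<not> 2 \<le> a"
  have "h x y" if "x \<in> V" "y \<in> V" "x \<noteq> y" for x y
  proof (rule ccontr)
    assume "\<not> h x y"
    then have "card {x, y} \<le> a"
      using that H.irrefl H.sym by (intro H.card_stable_le) (auto simp: stable_def)
    then show False using that \<open>\<not> 2 \<le> a\<close> by simp
  qed
  then have "stable k V" using disj K.irrefl unfolding stable_def by metis
  then have "card V \<le> b" by (intro K.card_stable_le) auto
  then show False using cardV by simp
qed

text \<open>In the small case \<open>a = b = 2\<close>, and a triangle of one graph is a stable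
  triple of the other, so both satisfy the hypotheses of
  \<open>contains_C5_of_card_5\<close>.\<close>

lemma critical_pair:
  assumes H: "critical_graph h V a" and K: "critical_graph k V b"
    and disj: "\<And>x y. h x y \<Longrightarrow> \<not> k x y" and cardV: "card V = a + b + 1"
  shows "contains_C5 h V \<and> contains_C5 k V \<or> contains_P0 h V \<and> (contains_P0 k V \<or> contains_P_compl k V)
    \<or> contains_P0 k V \<and> contains_P_compl h V"
proof (cases "3 \<le> a \<or> 3 \<le> b")
  case True
  show ?thesis using large_critical_pair[OF H K disj cardV True] .
next
  case False
  interpret H: critical_graph h V a by fact
  interpret K: critical_graph k V b by fact
  have disj': "\<not> h x y" if "k x y" for x y using that disj by blast
  have ab: "a = 2" "b = 2"
    using False two_le_of_disjoint_critical[OF H K disj cardV]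
      two_le_of_disjoint_critical[OF K H disj'] cardV by auto
  have h3: "\<not> stable h {x, y, z}" if "{x, y, z} \<subseteq> V" "distinct [x, y, z]" for x y z
    using H.card_stable_le[OF that(1)] that(2) ab by auto
  have k3: "\<not> stable k {x, y, z}" if "{x, y, z} \<subseteq> V" "distinct [x, y, z]" for x y z
    using K.card_stable_le[OF that(1)] that(2) ab by auto
  have "contains_C5 h V"
  proof (rule contains_C5_of_card_5[OF H.sym H.irrefl])
    show "card V = 5" using cardV ab by simp
    fix x y z assume xyz: "x \<in> V" "y \<in> V" "z \<in> V"
    show "\<not> h x z" if "h x y" "h y z"
    proof
      assume "h x z"
      then have "stable k {x, y, z}" "distinct [x, y, z]"
        using that disj K.irrefl H.irrefl unfolding stable_def by (auto dest: H.sym K.sym)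
      then show False using k3 xyz by blast
    qed
    show "h x z" if "distinct [x, y, z]" "\<not> h x y" "\<not> h y z"
    proof (rule ccontr)
      assume "\<not> h x z"
      then have "stable h {x, y, z}"
        using that H.irrefl unfolding stable_def by (auto dest: H.sym)
      then show False using h3 xyz that by blast
    qed
  qed
  moreover have "contains_C5 k V"
  proof (rule contains_C5_of_card_5[OF K.sym K.irrefl])
    show "card V = 5" using cardV ab by simp
    fix x y z assume xyz: "x \<in> V" "y \<in> V" "z \<in> V"
    show "\<not> k x z" if "k x y" "k y z"
    proof
      assume "k x z"
      then have "stable h {x, y, z}" "distinct [x, y, z]"
        using that disj' K.irrefl H.irrefl unfolding stable_def by (auto dest: H.sym K.sym)
      then show False using h3 xyz by blast
    qed
    show "k x z" if "distinct [x, y, z]" "\<not> k x y" "\<not> k y z"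
    proof (rule ccontr)
      assume "\<not> k x z"
      then have "stable k {x, y, z}"
        using that K.irrefl unfolding stable_def by (auto dest: K.sym)
      then show False using k3 xyz that by blast
    qed
  qed
  ultimately show ?thesis by blast
qed

section \<open>Translation to induced subgraphs\<close>

text \<open>The induced subgraph is the one on the image of \<open>f\<close>; since
  \<open>contains\<close> asks for an isomorphism from the subgraph to \<open>H\<close>, the inverse
  \<open>g\<close> of \<open>f\<close> is used.\<close>

lemma containsI:
  assumes G: "pair_wf_digraph G" and H: "pair_wf_digraph H"
    and f: "inj_on f (pverts H)" "f ` pverts H \<subseteq> pverts G"
    and arcs: "\<And>x y. x \<in> pverts H \<Longrightarrow> y \<in> pverts H \<Longrightarrow> (x, y) \<in> parcs H \<longleftrightarrow> (f x, f y) \<in> parcs G"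
  shows "contains G H"
proof -
  interpret G: pair_wf_digraph G by fact
  interpret H: pair_wf_digraph H by fact
  define S where "S = with_proj G \<restriction> (f ` pverts H)"
  define g where "g = the_inv_into (pverts H) f"
  have gf: "g (f x) = x" if "x \<in> pverts H" for x
    using f(1) that by (simp add: g_def the_inv_into_f_f)
  have S: "induced_subgraph S (with_proj G)"
    unfolding S_def using f(2) by (intro G.induced_induce) auto
  have vS: "verts S = f ` pverts H" and tS: "tail S = fst" and hS: "head S = snd"
    by (simp_all add: S_def)
  have aS: "arcs S = map_prod f f ` parcs H"
  proof (intro equalityI subsetI)
    fix e assume "e \<in> arcs S"
    then obtain x y where xy: "e = (f x, f y)" "x \<in> pverts H" "y \<in> pverts H" "(f x, f y) \<in> parcs G"
      by (cases e) (auto simp: S_def)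
    then have "(x, y) \<in> parcs H" using arcs by blast
    then show "e \<in> map_prod f f ` parcs H" using xy(1) by force
  next
    fix e assume "e \<in> map_prod f f ` parcs H"
    then show "e \<in> arcs S"
      using arcs by (auto simp: S_def dest: H.in_arcsD1 H.in_arcsD2)
  qed
  define hom where "hom = \<lparr>iso_verts = g, iso_arcs = map_prod g g, iso_head = snd, iso_tail = fst\<rparr>"
  have "wf_digraph S" unfolding S_def by (rule G.wellformed_induce_subgraph)
  moreover have g: "inj_on g (f ` pverts H)" using gf by (auto simp: inj_on_def)
  moreover have "inj_on (map_prod g g) (map_prod f f ` parcs H)"
    by (rule inj_on_subset[OF map_prod_inj_on[OF g g]]) (auto dest: H.in_arcsD1 H.in_arcsD2)
  ultimately have "pre_digraph.digraph_isomorphism S hom"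
    by (simp add: pre_digraph.digraph_isomorphism_def hom_def vS aS tS hS)
  moreover have "with_proj H = app_iso hom S"
  proof -
    have "g ` f ` pverts H = pverts H" using gf by (force simp: image_iff)
    moreover have "map_prod g g ` map_prod f f ` parcs H = id ` parcs H"
    proof -
      have "g (f x) = x \<and> g (f y) = y" if "(x, y) \<in> parcs H" for x y
        using gf H.in_arcsD1[OF that] H.in_arcsD2[OF that] by blast
      then show ?thesis unfolding image_image by (intro image_cong) auto
    qed
    ultimately show ?thesis by (simp add: app_iso_def hom_def with_proj_def vS aS)
  qed
  ultimately show ?thesis using S unfolding contains_def digraph_iso_def by blast
qed

lemma contains_if_nonadj:
  assumes G: "pair_graph G" and W: "W \<subseteq> pverts G"
    and h: "\<And>u v. u \<in> W \<Longrightarrow> v \<in> W \<Longrightarrow> u \<noteq> v \<Longrightarrow> (u, v) \<in> parcs G \<longleftrightarrow> \<not> h u v"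
    and H: "pair_wf_digraph H" "\<And>x. (x, x) \<notin> parcs H"
    and f: "inj_on f (pverts H)" "f ` pverts H \<subseteq> W"
    and arcs: "\<And>x y. x \<in> pverts H \<Longrightarrow> y \<in> pverts H \<Longrightarrow> x \<noteq> y \<Longrightarrow> (x, y) \<in> parcs H \<longleftrightarrow> \<not> h (f x) (f y)"
  shows "contains G H"
proof (rule containsI[OF _ H(1) f(1)])
  interpret G: pair_graph G by fact
  show "pair_wf_digraph G" by unfold_locales
  show "f ` pverts H \<subseteq> pverts G" using f(2) W by blast
  fix x y assume xy: "x \<in> pverts H" "y \<in> pverts H"
  show "(x, y) \<in> parcs H \<longleftrightarrow> (f x, f y) \<in> parcs G"
  proof (cases "x = y")
    case True
    then show ?thesis using H(2) G.pair_no_loops by fastforce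
  next
    case False
    then have "f x \<noteq> f y" using f(1) xy by (auto dest: inj_onD)
    then show ?thesis using arcs[OF xy False] h[of "f x" "f y"] xy f(2) by blast
  qed
qed

section \<open>The graphs \<open>P0\<close>, \<open>P1\<close>, \<open>P2\<close> and embeddings of
  the forbidden graphs\<close>

lemma parcs_P0 [simp]:
  "(va i, va j) \<in> parcs P0 \<longleftrightarrow> i \<in> {1,2,3} \<and> j \<in> {1,2,3} \<and> i \<noteq> j"
  "(va i, vb j) \<in> parcs P0 \<longleftrightarrow> i \<in> {1,2,3} \<and> j \<in> {1,2,3} \<and> i \<noteq> j"
  "(vb i, va j) \<in> parcs P0 \<longleftrightarrow> i \<in> {1,2,3} \<and> j \<in> {1,2,3} \<and> i \<noteq> j"
  "(vb i, vb j) \<notin> parcs P0"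
  "(va i, vc) \<notin> parcs P0" "(vc, va i) \<notin> parcs P0" "(vc, vc) \<notin> parcs P0"
  "(vb i, vc) \<in> parcs P0 \<longleftrightarrow> i = 1" "(vc, vb i) \<in> parcs P0 \<longleftrightarrow> i = 1"
  by (auto simp: P0_def Let_def)

lemma pverts_P0: "pverts P0 = {va 1, va 2, va 3, vb 1, vb 2, vb 3, vc}"
  by (auto simp: P0_def Let_def)

lemma wf_P0: "pair_wf_digraph P0"
  by unfold_locales (auto simp: P0_def Let_def)

lemma P0_loopfree: "(x, x) \<notin> parcs P0"
  by (cases x) auto

lemma wf_complement: "pair_wf_digraph (complement G)"
  by unfold_locales (auto simp: complement_def)

lemma pverts_add_edge [simp]: "pverts (add_edge G u v) = pverts G"
  and parcs_add_edge [simp]: "parcs (add_edge G u v) = insert (u, v) (insert (v, u) (parcs G))"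
  by (auto simp: add_edge_def)

lemma wf_add_edge:
  assumes "pair_wf_digraph G" "u \<in> pverts G" "v \<in> pverts G"
  shows "pair_wf_digraph (add_edge G u v)"
  using assms by (auto simp: pair_wf_digraph_def)

lemma wf_P1: "pair_wf_digraph P1" and wf_P2: "pair_wf_digraph P2"
  unfolding P1_def P2_def by (intro wf_add_edge wf_P0; simp add: pverts_P0)+

text \<open>Indices other than 1 and 2 are sent to the third vertex; only 1, 2 and 3 occur in the
  graphs embedded.\<close>

fun embed_vertex :: "'a \<Rightarrow> 'a \<Rightarrow> 'a \<Rightarrow> 'a \<Rightarrow> 'a \<Rightarrow> 'a \<Rightarrow> 'a \<Rightarrow> vertex \<Rightarrow> 'a" where
  "embed_vertex a1 a2 a3 b1 b2 b3 c (va n) = (if n = 1 then a1 else if n = 2 then a2 else a3)"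
| "embed_vertex a1 a2 a3 b1 b2 b3 c (vb n) = (if n = 1 then b1 else if n = 2 then b2 else b3)"
| "embed_vertex a1 a2 a3 b1 b2 b3 c vc = c"

lemma net_two_more:
  assumes "3 \<le> card Y" "i \<in> Y"
  obtains k l where "k \<in> Y" "l \<in> Y" "distinct [i, k, l]"
proof -
  have "2 \<le> card (Y - {i})" using assms by (simp add: card_Diff_singleton_if)
  then obtain S where "S \<subseteq> Y - {i}" "card S = 2" by (meson obtain_subset_with_card_n)
  then obtain k l where "k \<noteq> l" "{k, l} \<subseteq> Y - {i}" by (auto simp: card_2_iff)
  then show ?thesis using that[of k l] by auto
qed

text \<open>\<open>G\<close> is the complement of \<open>h\<close> on \<open>W\<close>, so a
  configuration found in \<open>h\<close> appears complemented in \<open>G\<close>.\<close>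

locale nonadjacency =
  fixes G :: "'a pair_pre_digraph" and h :: "'a \<Rightarrow> 'a \<Rightarrow> bool" and W :: "'a set"
  assumes G: "pair_graph G" and W: "W \<subseteq> pverts G"
    and arcs_iff: "\<And>u v. u \<in> W \<Longrightarrow> v \<in> W \<Longrightarrow> u \<noteq> v \<Longrightarrow> (u, v) \<in> parcs G \<longleftrightarrow> \<not> h u v"
    and h_sym: "\<And>u v. h u v \<Longrightarrow> h v u"
begin

lemma apex_facts:
  assumes N: "net_with_apex h W Y z v" and Y: "i \<in> Y" "k \<in> Y" "l \<in> Y" "distinct [i, k, l]"
  shows "distinct [v, i, k, l, z i, z k, z l]" "{v, i, k, l, z i, z k, z l} \<subseteq> W"
    and "\<not> h i k" "\<not> h i l" "\<not> h k l" "\<not> h k i" "\<not> h l i" "\<not> h l k"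
    and "h i (z i)" "h k (z k)" "h l (z l)" "h (z i) i" "h (z k) k" "h (z l) l"
    and "\<not> h i (z k)" "\<not> h i (z l)" "\<not> h k (z i)" "\<not> h k (z l)" "\<not> h l (z i)" "\<not> h l (z k)"
    and "\<not> h (z k) i" "\<not> h (z l) i" "\<not> h (z i) k" "\<not> h (z l) k" "\<not> h (z i) l" "\<not> h (z k) l"
    and "h (z i) (z k)" "h (z i) (z l)" "h (z k) (z l)" "h (z k) (z i)" "h (z l) (z i)" "h (z l) (z k)"
proof -
  have net: "net h W Y z" and v: "v \<in> W" "v \<notin> Y" "v \<notin> z ` Y"
    using N by (auto simp: net_with_apex_def)
  have zn: "z y \<noteq> y'" if "y \<in> Y" "y' \<in> Y" for y y' using net_disjoint[OF net] that by blast
  have zi: "z y \<noteq> z y'" if "y \<in> Y" "y' \<in> Y" "y \<noteq> y'" for y y'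
    using net_inj[OF net] that by (auto dest: inj_onD)
  show "distinct [v, i, k, l, z i, z k, z l]"
    using Y v zn zi by simp (metis imageI)
  show "{v, i, k, l, z i, z k, z l} \<subseteq> W" using net_subset[OF net] Y v by auto
  show "\<not> h i k" "\<not> h i l" "\<not> h k l" "\<not> h k i" "\<not> h l i" "\<not> h l k"
    using Y net_stable[OF net] by auto
  have "h y' (z y) \<longleftrightarrow> y' = y" "h (z y) y' \<longleftrightarrow> y' = y" if "y \<in> Y" "y' \<in> Y" for y y'
    using net_match[OF net that(2,1)] h_sym by blast+
  then show "h i (z i)" "h k (z k)" "h l (z l)" "h (z i) i" "h (z k) k" "h (z l) l"
    "\<not> h i (z k)" "\<not> h i (z l)" "\<not> h k (z i)" "\<not> h k (z l)" "\<not> h l (z i)" "\<not> h l (z k)"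
    "\<not> h (z k) i" "\<not> h (z l) i" "\<not> h (z i) k" "\<not> h (z l) k" "\<not> h (z i) l" "\<not> h (z k) l"
    using Y by auto
  show "h (z i) (z k)" "h (z i) (z l)" "h (z k) (z l)" "h (z k) (z i)" "h (z l) (z i)" "h (z l) (z k)"
    using Y net_clique[OF net] by auto
qed

lemma contains_complement_P0:
  assumes "contains_P0 h W"
  shows "contains G (complement P0)"
proof -
  obtain Y z v i where N: "net_with_apex h W Y z v" and i: "i \<in> Y"
    and v: "\<And>y. y \<in> Y \<Longrightarrow> h v y \<longleftrightarrow> y \<noteq> i" "\<And>y. y \<in> Y \<Longrightarrow> h v (z y) \<longleftrightarrow> y \<noteq> i"
    using assms unfolding contains_P0_def by blast
  obtain k l where kl: "k \<in> Y" "l \<in> Y" "distinct [i, k, l]"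
    using net_two_more[of Y i] N i by (auto simp: net_with_apex_def)
  note facts = apex_facts[OF N i kl]
  have v': "h v k" "h v l" "h k v" "h l v" "\<not> h v i" "\<not> h i v"
    "h v (z k)" "h v (z l)" "h (z k) v" "h (z l) v" "\<not> h v (z i)" "\<not> h (z i) v"
    using v[OF i] v[OF kl(1)] v[OF kl(2)] kl(3) h_sym by auto
  \<comment> \<open>The apex becomes $a_1$, the clique \<open>z i, z k, z l\<close> becomes $b_1,
    a_3, a_2$, and the pendants \<open>i, k, l\<close> become $c, b_2, b_3$.\<close>
  let ?f = "embed_vertex v (z l) (z k) (z i) k l i"
  have pv: "pverts (complement P0) = {va 1, va 2, va 3, vb 1, vb 2, vb 3, vc}"
    by (simp add: complement_def pverts_P0)
  show ?thesis
  proof (rule contains_if_nonadj[OF G W arcs_iff wf_complement, where f = ?f])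
    show "(x, x) \<notin> parcs (complement P0)" for x by (simp add: complement_def)
    show "inj_on ?f (pverts (complement P0))" using facts(1) unfolding pv by (auto simp: inj_on_def)
    show "?f ` pverts (complement P0) \<subseteq> W" using facts(2) unfolding pv by auto
    fix x y assume xy: "x \<in> pverts (complement P0)" "y \<in> pverts (complement P0)" "x \<noteq> y"
    then have "(x, y) \<in> parcs (complement P0) \<longleftrightarrow> (x, y) \<notin> parcs P0" by (simp add: complement_def)
    also have "\<dots> \<longleftrightarrow> \<not> h (?f x) (?f y)"
      using xy unfolding pv by (elim insertE emptyE) (simp_all add: facts(3-) v')
    finally show "(x, y) \<in> parcs (complement P0) \<longleftrightarrow> \<not> h (?f x) (?f y)" .
  qed
qed

lemma contains_family_P:
  assumes "contains_P_compl h W"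
  shows "\<exists>H\<in>family_P. contains G H"
proof -
  obtain Y z v i where N: "net_with_apex h W Y z v" and i: "i \<in> Y"
    and v: "\<And>y. y \<in> Y \<Longrightarrow> h v y" "\<not> h v (z i)"
    using assms unfolding contains_P_compl_def by blast
  obtain k l where kl: "k \<in> Y" "l \<in> Y" "distinct [i, k, l]"
    using net_two_more[of Y i] N i by (auto simp: net_with_apex_def)
  have vs: "h x y \<longleftrightarrow> h y x" for x y using h_sym by blast
  \<comment> \<open>One embedding covers all three graphs: the optional edges from $c$ to $b_2$ and
    $b_3$ are present exactly when \<open>v\<close> misses \<open>z k\<close> and
    \<open>z l\<close>.\<close>
  have embed: "contains G H"
    if H: "pair_wf_digraph H" "pverts H = pverts P0" "\<And>x. (x, x) \<notin> parcs H"
      and arcs: "\<And>x y. (x, y) \<in> parcs H \<longleftrightarrow> (x, y) \<in> parcs P0 \<or>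
        (x, y) \<in> {(vc, vb 2), (vb 2, vc)} \<and> \<not> h v (z k) \<or> (x, y) \<in> {(vc, vb 3), (vb 3, vc)} \<and> \<not> h v (z l)"
      and kl: "k \<in> Y" "l \<in> Y" "distinct [i, k, l]" for H k l
  proof -
    note facts = apex_facts[OF N i kl]
    have v': "h v i" "h i v" "h v k" "h k v" "h v l" "h l v" "\<not> h v (z i)" "\<not> h (z i) v"
      "h (z k) v \<longleftrightarrow> h v (z k)" "h (z l) v \<longleftrightarrow> h v (z l)"
      using v i kl vs by blast+
    let ?f = "embed_vertex i k l (z i) (z k) (z l) v"
    show ?thesis
    proof (rule contains_if_nonadj[OF G W arcs_iff H(1), where f = ?f])
      show "(x, x) \<notin> parcs H" for x by (rule H(3))
      show "inj_on ?f (pverts H)" using facts(1) unfolding H(2) pverts_P0 by (auto simp: inj_on_def)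
      show "?f ` pverts H \<subseteq> W" using facts(2) unfolding H(2) pverts_P0 by auto
      fix x y assume xy: "x \<in> pverts H" "y \<in> pverts H" "x \<noteq> y"
      then show "(x, y) \<in> parcs H \<longleftrightarrow> \<not> h (?f x) (?f y)"
        unfolding H(2) pverts_P0 by (elim insertE emptyE) (simp_all add: arcs facts(3-) v')
    qed
  qed
  consider "h v (z k)" "h v (z l)" | "\<not> h v (z k)" "h v (z l)" | "h v (z k)" "\<not> h v (z l)"
    | "\<not> h v (z k)" "\<not> h v (z l)" by blast
  then show ?thesis
  proof cases
    case 1
    have "contains G P0"
      by (rule embed[OF wf_P0 _ P0_loopfree _ kl]) (use 1 in auto)
    then show ?thesis by (simp add: family_P_def)
  next
    case 2
    have "contains G P1"
      by (rule embed[OF wf_P1 _ _ _ kl]) (use 2 P0_loopfree in \<open>auto simp: P1_def\<close>)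
    then show ?thesis by (simp add: family_P_def)
  next
    case 3
    have "contains G P1"
      \<comment> \<open>\<open>P1\<close> adds its edge at $b_2$, so \<open>k\<close> and
        \<open>l\<close> trade places.\<close>
      by (rule embed[OF wf_P1, of l k]) (use 3 P0_loopfree kl in \<open>auto simp: P1_def\<close>)
    then show ?thesis by (simp add: family_P_def)
  next
    case 4
    have "contains G P2"
      by (rule embed[OF wf_P2 _ _ _ kl]) (use 4 P0_loopfree in \<open>auto simp: P1_def P2_def\<close>)
    then show ?thesis by (simp add: family_P_def)
  qed
qed

lemma contains_cycle_5:
  assumes "contains_C5 h W"
  shows "contains G (cycle_graph 5)"
proof -
  obtain x0 x1 x2 x3 x4 where d: "distinct [x0, x1, x2, x3, x4]" and sub: "{x0, x1, x2, x3, x4} \<subseteq> W"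
    and adj: "h x0 x1" "h x1 x2" "h x2 x3" "h x3 x4" "h x4 x0"
      "\<not> h x0 x2" "\<not> h x1 x3" "\<not> h x2 x4" "\<not> h x3 x0" "\<not> h x4 x1"
    using assms unfolding contains_C5_def by blast
  have adj': "h x1 x0" "h x2 x1" "h x3 x2" "h x4 x3" "h x0 x4"
    "\<not> h x2 x0" "\<not> h x3 x1" "\<not> h x4 x2" "\<not> h x0 x3" "\<not> h x1 x4"
    using adj h_sym by blast+
  \<comment> \<open>The complement of a 5-cycle is the 5-cycle of its chords.\<close>
  let ?f = "(!) [x0, x2, x4, x1, x3]"
  have pv: "pverts (cycle_graph 5) = {0, 1, 2, 3, 4}" by (auto simp: cycle_graph_def)
  show ?thesis
  proof (rule contains_if_nonadj[OF G W arcs_iff, where f = ?f])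
    show "pair_wf_digraph (cycle_graph 5)" by unfold_locales (auto simp: cycle_graph_def)
    show "(i, i) \<notin> parcs (cycle_graph 5)" for i
    proof
      assume "(i, i) \<in> parcs (cycle_graph 5)"
      then have "i < 5" "i = (i + 1) mod 5" by (auto simp: cycle_graph_def)
      then show False by presburger
    qed
    show "inj_on ?f (pverts (cycle_graph 5))"
      using d unfolding pv by (auto simp: inj_on_def)
    show "?f ` pverts (cycle_graph 5) \<subseteq> W" using sub unfolding pv by auto
    fix x y assume "x \<in> pverts (cycle_graph 5)" "y \<in> pverts (cycle_graph 5)" "x \<noteq> y"
    then show "(x, y) \<in> parcs (cycle_graph 5) \<longleftrightarrow> \<not> h (?f x) (?f y)"
      unfolding pv by (elim insertE emptyE) (simp_all add: cycle_graph_def adj adj')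
  qed
qed

lemma contains_family_F:
  assumes sub: "{x1, x2, x3, y1, y2, y3} \<subseteq> W" and dx: "distinct [x1, x2, x3]" and dy: "distinct [y1, y2, y3]"
    and stx: "stable h {x1, x2, x3}" and sty: "stable h {y1, y2, y3}"
    and match: "h x1 y1" "h x2 y2" "h x3 y3" and irrefl: "\<And>x. \<not> h x x"
  shows "\<exists>H\<in>family_F. contains G H"
proof -
  interpret G: pair_graph G by (rule G)
  \<comment> \<open>\<open>vc\<close> is not a vertex of the graphs in \<open>family_F\<close>,
    hence the arbitrary image.\<close>
  let ?f = "embed_vertex x1 x2 x3 y1 y2 y3 undefined"
  define V where "V = {va 1, va 2, va 3, vb 1, vb 2, vb 3}"
  \<comment> \<open>The remaining adjacencies being arbitrary in \<open>family_F\<close>, the member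
    is obtained by pulling \<open>G\<close> back along \<open>?f\<close>.\<close>
  define H where "H = \<lparr>pverts = V, parcs = {(p, q). p \<in> V \<and> q \<in> V \<and> (?f p, ?f q) \<in> parcs G}\<rparr>"
  have Gsym: "(v, u) \<in> parcs G" if "(u, v) \<in> parcs G" for u v
    using G.pair_sym_arcs that by (auto simp: symmetric_def dest: symD)
  have Gloop: "(u, u) \<notin> parcs G" for u using G.pair_no_loops by fastforce
  have arcs: "(p, q) \<in> parcs H \<longleftrightarrow> p \<in> V \<and> q \<in> V \<and> (?f p, ?f q) \<in> parcs G" for p q
    by (simp add: H_def)
  have V: "pverts H = V" "finite V" by (simp_all add: H_def V_def)
  have "parcs H \<subseteq> V \<times> V" by (auto simp: H_def)
  then have "finite (parcs H)" using V(2) by (meson finite_SigmaI finite_subset)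
  then have "pair_graph H"
    using Gloop V by unfold_locales (auto simp: arcs symmetric_def intro!: symI dest: Gsym)
  have adj: "(u, v) \<in> parcs G" if "stable h S" "S \<subseteq> W" "u \<in> S" "v \<in> S" "u \<noteq> v" for u v S
    using that arcs_iff unfolding stable_def by blast
  have nadj: "(u, v) \<notin> parcs G" if "h u v" "u \<in> W" "v \<in> W" for u v
    using that arcs_iff irrefl by blast
  have ne: "x1 \<noteq> y1" "x2 \<noteq> y2" "x3 \<noteq> y3" using match irrefl by auto
  have ne': "x1 \<noteq> y2" "x1 \<noteq> y3" "x2 \<noteq> y1" "x2 \<noteq> y3" "x3 \<noteq> y1" "x3 \<noteq> y2"
    using match sty by (auto simp: stable_def)
  have fa: "?f ` va ` {1, 2, 3} = {x1, x2, x3}" and fb: "?f ` vb ` {1, 2, 3} = {y1, y2, y3}" by auto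
  have inj: "inj_on ?f V" using dx dy ne ne' by (auto simp: V_def inj_on_def)
  have clique: "clique (with_proj H) K" if "K \<subseteq> V" "stable h (?f ` K)" "?f ` K \<subseteq> W" for K
    unfolding clique_def
  proof (intro conjI ballI impI)
    show "K \<subseteq> verts (with_proj H)" using that(1) V by simp
    fix u v assume uv: "u \<in> K" "v \<in> K" "u \<noteq> v"
    then have "?f u \<noteq> ?f v" using inj that(1) by (meson inj_onD subsetD)
    then have "(?f u, ?f v) \<in> parcs G" using adj[OF that(2,3)] uv by blast
    then show "u \<rightarrow>\<^bsub>with_proj H\<^esub> v" using uv that(1) by (simp only: with_proj_simps arcs) blast
  qed
  have "H \<in> family_F"
    unfolding family_F_def mem_Collect_eq
  proof (intro conjI ballI)
    show "pair_graph H" by fact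
    show "pverts H = va ` {1, 2, 3} \<union> vb ` {1, 2, 3}" by (auto simp: V V_def)
    show "clique (with_proj H) (va ` {1, 2, 3})" using sub stx by (intro clique) (simp_all only: fa, auto simp: V_def)
    show "clique (with_proj H) (vb ` {1, 2, 3})" using sub sty by (intro clique) (simp_all only: fb, auto simp: V_def)
    fix i :: nat assume "i \<in> {1, 2, 3}"
    then have "(?f (va i), ?f (vb i)) \<notin> parcs G" using sub match by (auto dest: nadj)
    then show "(va i, vb i) \<notin> parcs H" using arcs by blast
  qed
  moreover have "contains G H"
  proof (rule containsI[where f = ?f])
    show "pair_wf_digraph G" by unfold_locales
    show "pair_wf_digraph H" using \<open>pair_graph H\<close> by (simp add: pair_graph_def pair_digraph_def pair_fin_digraph_def)
    show "inj_on ?f (pverts H)" using inj V by simp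
    show "?f ` pverts H \<subseteq> pverts G" using sub W by (auto simp: V V_def)
  qed (simp add: arcs V)
  ultimately show ?thesis by blast
qed

end

section \<open>Clique numbers and minimal violating sets\<close>

definition rel_clique :: "'a rel \<Rightarrow> 'a set \<Rightarrow> bool" where
  "rel_clique A K \<longleftrightarrow> (\<forall>u\<in>K. \<forall>v\<in>K. u \<noteq> v \<longrightarrow> (u, v) \<in> A)"

text \<open>Working with arc relations and vertex sets treats \<open>B\<close>, \<open>R\<close> and
  their union alike, without building induced subgraphs.\<close>

definition rel_clique_number :: "'a rel \<Rightarrow> 'a set \<Rightarrow> nat" where
  "rel_clique_number A X = Max (card ` {K. K \<subseteq> X \<and> rel_clique A K})"

lemma finite_rel_cliques: "finite X \<Longrightarrow> finite (card ` {K. K \<subseteq> X \<and> rel_clique A K})"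
  by simp

lemma rel_clique_number_ge:
  "finite X \<Longrightarrow> K \<subseteq> X \<Longrightarrow> rel_clique A K \<Longrightarrow> card K \<le> rel_clique_number A X"
  unfolding rel_clique_number_def by (intro Max_ge finite_rel_cliques) auto

lemma rel_clique_number_attained:
  assumes "finite X"
  obtains K where "K \<subseteq> X" "rel_clique A K" "card K = rel_clique_number A X"
proof -
  have "{} \<in> {K. K \<subseteq> X \<and> rel_clique A K}" by (simp add: rel_clique_def)
  then have "rel_clique_number A X \<in> card ` {K. K \<subseteq> X \<and> rel_clique A K}"
    unfolding rel_clique_number_def by (intro Max_in finite_rel_cliques assms) blast
  then show ?thesis using that by fastforce
qed

lemma rel_clique_number_mono:
  assumes "finite X" "Z \<subseteq> X"
  shows "rel_clique_number A Z \<le> rel_clique_number A X"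
proof -
  have "finite Z" using assms by (rule rev_finite_subset)
  then obtain K where "K \<subseteq> Z" "rel_clique A K" "card K = rel_clique_number A Z"
    by (rule rel_clique_number_attained)
  then show ?thesis using rel_clique_number_ge[of X K A] assms by simp
qed

lemma clique_number_restrict:
  assumes "tail G = fst" "head G = snd"
  shows "\<omega> (G \<restriction> X) = rel_clique_number (arcs G) X"
proof -
  have "clique (G \<restriction> X) K \<longleftrightarrow> K \<subseteq> X \<and> rel_clique (arcs G) K" for K
    using assms by (auto simp: clique_def rel_clique_def arcs_ends_conv subset_eq)
  then show ?thesis by (simp add: clique_number_def rel_clique_number_def)
qed

text \<open>A largest clique of the union inside a violating set again violates additivity, as
  clique numbers are monotone. In a smallest such \<open>W\<close>, deleting \<open>v\<close>
  restores the inequality although the left side cannot grow and \<open>card W\<close> drops by only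
  one; so equality holds throughout.\<close>

lemma minimal_nonadditive:
  assumes B: "pair_graph B" and nonadd: "\<not> additive_pair B R"
  obtains W a b where "W \<subseteq> pverts B" "rel_clique (parcs B \<union> parcs R) W"
    "card W = a + b + 1" "rel_clique_number (parcs B) W = a" "rel_clique_number (parcs R) W = b"
    "\<And>v. v \<in> W \<Longrightarrow> rel_clique_number (parcs B) (W - {v}) = a"
    "\<And>v. v \<in> W \<Longrightarrow> rel_clique_number (parcs R) (W - {v}) = b"
proof -
  let ?\<beta> = "rel_clique_number (parcs B)" and ?\<rho> = "rel_clique_number (parcs R)"
  define bad where "bad X \<longleftrightarrow> X \<subseteq> pverts B \<and> rel_clique (parcs B \<union> parcs R) X \<and> ?\<beta> X + ?\<rho> X < card X" for X
  have fin: "finite X" if "X \<subseteq> pverts B" for X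
    using that B finite_subset pair_fin_digraph.pair_finite_verts
    by (metis pair_digraph_def pair_graph_def)
  obtain X where X: "X \<subseteq> pverts B" "?\<beta> X + ?\<rho> X < rel_clique_number (parcs B \<union> parcs R) X"
    using nonadd unfolding additive_pair_def by (auto simp: clique_number_restrict union_def not_le)
  obtain K where K: "K \<subseteq> X" "rel_clique (parcs B \<union> parcs R) K" "card K = rel_clique_number (parcs B \<union> parcs R) X"
    using fin[OF X(1)] by (rule rel_clique_number_attained)
  have "bad K"
    using K X rel_clique_number_mono[OF fin[OF X(1)] K(1), of "parcs B"]
      rel_clique_number_mono[OF fin[OF X(1)] K(1), of "parcs R"] by (auto simp: bad_def)
  then obtain W where W: "bad W" and min: "\<And>Z. bad Z \<Longrightarrow> card W \<le> card Z"
    using ex_has_least_nat[of bad K card] by blast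
  have finW: "finite W" using W fin by (auto simp: bad_def)
  have crit: "?\<beta> (W - {v}) = ?\<beta> W \<and> ?\<rho> (W - {v}) = ?\<rho> W \<and> card W = ?\<beta> W + ?\<rho> W + 1" if v: "v \<in> W" for v
  proof -
    have cardv: "card W = Suc (card (W - {v}))" using v finW by (simp only: card_Suc_Diff1)
    then have "\<not> bad (W - {v})" using min by fastforce
    then have "card (W - {v}) \<le> ?\<beta> (W - {v}) + ?\<rho> (W - {v})"
      using W by (auto simp: bad_def rel_clique_def not_less)
    moreover have "?\<beta> (W - {v}) \<le> ?\<beta> W" "?\<rho> (W - {v}) \<le> ?\<rho> W"
      using finW by (auto intro: rel_clique_number_mono)
    moreover have "?\<beta> W + ?\<rho> W < card W" using W by (simp add: bad_def)
    ultimately show ?thesis using cardv by linarith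
  qed
  have "W \<noteq> {}" using W by (auto simp: bad_def)
  then have "card W = ?\<beta> W + ?\<rho> W + 1" using crit by blast
  then show ?thesis using that[of W "?\<beta> W" "?\<rho> W"] W crit by (simp add: bad_def)
qed

text \<open>Confined to \<open>W\<close>, so that symmetry and edge-disjointness hold for all pairs
  of elements, as \<open>critical_graph\<close> and \<open>critical_pair\<close> require.\<close>

definition nonadj_on :: "'a pair_pre_digraph \<Rightarrow> 'a set \<Rightarrow> 'a \<Rightarrow> 'a \<Rightarrow> bool" where
  "nonadj_on G W u v \<longleftrightarrow> u \<in> W \<and> v \<in> W \<and> u \<noteq> v \<and> (u, v) \<notin> parcs G"

lemma nonadjacency_nonadj_on:
  assumes "pair_graph G" "W \<subseteq> pverts G"
  shows "nonadjacency G (nonadj_on G W) W"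
proof -
  interpret G: pair_graph G by fact
  have "(v, u) \<in> parcs G" if "(u, v) \<in> parcs G" for u v
    using G.pair_sym_arcs that by (auto simp: symmetric_def dest: symD)
  then have "(v, u) \<in> parcs G \<longleftrightarrow> (u, v) \<in> parcs G" for u v by blast
  then show ?thesis using assms by unfold_locales (auto simp: nonadj_on_def)
qed

lemma stable_nonadj_on: "S \<subseteq> W \<Longrightarrow> stable (nonadj_on G W) S \<longleftrightarrow> rel_clique (parcs G) S"
  by (auto simp: stable_def nonadj_on_def rel_clique_def)

text \<open>Stable sets of \<open>nonadj_on G W\<close> inside \<open>W\<close> are cliques of
  \<open>G\<close>; a largest clique in \<open>W - {v}\<close> is the set that \<open>avoid\<close>
  asks for.\<close>

lemma critical_nonadj_on:
  assumes G: "pair_graph G" and W: "W \<subseteq> pverts G" and F: "\<not> (\<exists>H\<in>family_F. contains G H)"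
    and a: "rel_clique_number (parcs G) W = a"
    and crit: "\<And>v. v \<in> W \<Longrightarrow> rel_clique_number (parcs G) (W - {v}) = a"
  shows "critical_graph (nonadj_on G W) W a"
proof -
  interpret G: pair_graph G by fact
  interpret N: nonadjacency G "nonadj_on G W" W using G W by (rule nonadjacency_nonadj_on)
  have finW: "finite W" using W G.pair_finite_verts by (rule finite_subset)
  show ?thesis
  proof
    fix v assume "v \<in> W"
    obtain K where "K \<subseteq> W - {v}" "rel_clique (parcs G) K" "card K = rel_clique_number (parcs G) (W - {v})"
      using finW by (auto intro: rel_clique_number_attained[of "W - {v}" "parcs G"])
    moreover from this have "stable (nonadj_on G W) K" by (subst stable_nonadj_on) auto
    ultimately show "\<exists>S\<subseteq>W. stable (nonadj_on G W) S \<and> card S = a \<and> v \<notin> S"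
      using crit[OF \<open>v \<in> W\<close>] by auto
  next
    fix S assume "S \<subseteq> W" "stable (nonadj_on G W) S"
    then show "card S \<le> a" using rel_clique_number_ge[OF finW] a stable_nonadj_on by metis
  next
    fix x1 x2 x3 y1 y2 y3
    assume "{x1, x2, x3, y1, y2, y3} \<subseteq> W" "distinct [x1, x2, x3]" "distinct [y1, y2, y3]"
      "stable (nonadj_on G W) {x1, x2, x3}" "stable (nonadj_on G W) {y1, y2, y3}"
      "nonadj_on G W x1 y1" "nonadj_on G W x2 y2" "nonadj_on G W x3 y3"
    then have "\<exists>H\<in>family_F. contains G H"
      by (rule N.contains_family_F) (simp add: nonadj_on_def)
    then show False using F by contradiction
  next
    fix x y assume "nonadj_on G W x y"
    then show "nonadj_on G W y x" by (rule N.h_sym)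
  qed (auto simp: finW nonadj_on_def)
qed

theorem mainTheorem1:
  fixes B R :: "'a pair_pre_digraph"
  assumes "pair_graph B" and "pair_graph R" and "pverts B = pverts R"
  shows "additive_pair B R
    \<or> ((\<exists>H\<in>family_F. contains B H) \<or> (\<exists>H\<in>family_F. contains R H))
    \<or> (contains B (cycle_graph 5) \<and> contains R (cycle_graph 5))
    \<or> (contains B (complement P0) \<and> contains R (complement P0))
    \<or> (contains B (complement P0) \<and> (\<exists>H\<in>family_P. contains R H))
    \<or> (contains R (complement P0) \<and> (\<exists>H\<in>family_P. contains B H))"
proof (cases "additive_pair B R \<or> (\<exists>H\<in>family_F. contains B H) \<or> (\<exists>H\<in>family_F. contains R H)")
  case False
  then have nonadd: "\<not> additive_pair B R" and FB: "\<not> (\<exists>H\<in>family_F. contains B H)"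
    and FR: "\<not> (\<exists>H\<in>family_F. contains R H)" by blast+
  obtain W a b where W: "W \<subseteq> pverts B" "rel_clique (parcs B \<union> parcs R) W" "card W = a + b + 1"
    and ab: "rel_clique_number (parcs B) W = a" "rel_clique_number (parcs R) W = b"
    and crit: "\<And>v. v \<in> W \<Longrightarrow> rel_clique_number (parcs B) (W - {v}) = a"
      "\<And>v. v \<in> W \<Longrightarrow> rel_clique_number (parcs R) (W - {v}) = b"
    by (rule minimal_nonadditive[OF assms(1) nonadd]) (rule that)
  have WR: "W \<subseteq> pverts R" using W(1) assms(3) by simp
  interpret NB: nonadjacency B "nonadj_on B W" W using assms(1) W(1) by (rule nonadjacency_nonadj_on)
  interpret NR: nonadjacency R "nonadj_on R W" W using assms(2) WR by (rule nonadjacency_nonadj_on)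
  \<comment> \<open>\<open>W\<close> is a clique of the union, so no two of its vertices are
    non-adjacent in both graphs.\<close>
  have "\<not> nonadj_on R W x y" if "nonadj_on B W x y" for x y
    using that W(2) by (auto simp: nonadj_on_def rel_clique_def)
  from critical_pair[OF critical_nonadj_on[OF assms(1) W(1) FB ab(1) crit(1)]
      critical_nonadj_on[OF assms(2) WR FR ab(2) crit(2)] this W(3)]
  show ?thesis
    using NB.contains_cycle_5 NR.contains_cycle_5 NB.contains_complement_P0 NR.contains_complement_P0
      NB.contains_family_P NR.contains_family_P by blast
qed blast

end
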